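(* A graph $G\equiv(V,E)$ is an AMP essential graph, that is, $G=\mathcal{G}^*$ for some AMP Markov equivalence class $\mathcal{G}$ of chain graphs, if and only if $G$ satisfies the following three conditions: G1: $G$ is a chain graph, that is, is adicyclic. G2: For each $\xi\in\Xi_s(G)$, $G_{\bar\xi}$ satisfies property S (equivalently, property S$'$). G3: Each arrow in $G$ is well protected in $G$.
   Context: Graphs. All graphs are finite; between two distinct vertices there is at most one edge, which is either a line $a-b$ or an arrow $a\to b$. $a\Rightarrow b$ means $a\to b$ or $a-b$. For $A\subseteq V$, $G_A$ is the induced subgraph. A $k$-cycle ($k\ge 3$) is a sequence $(v_0,\dots,v_k=v_0)$, with $v_0,\dots,v_{k-1}$ distinct, such that $v_{i-1}\Rightarrow v_i$ for all $i$; it is semi-directed if at least one of these edges is an arrow, undirected if all are lines, and (for $k\ge4$) chordless if no two vertices nonconsecutive on the cycle are adjacent. A graph is adicyclic if it has no semi-directed cycles; a chain graph (CG) is an adicyclic graph. A triplex $(\{a,c\},b)$ occurs in a graph if $a,c$ are nonadjacent and the induced subgraph on $\{a,b,c\}$ is $a\to b\leftarrow c$ (an immorality), or $a\to b-c$ or $a-b\leftarrow c$ (flags). The skeleton is the graph obtained by forgetting orientations. AMP essential graph. Two CGs on the same vertex set are AMP Markov equivalent if they determine the same set of distributions under the AMP Markov property; by a known theorem of Andersson, Madigan and Perlman this holds iff they have the same skeleton and the same triplexes, which may be taken as the definition. For an equivalence class $\mathcal{G}$, the AMP essential graph $\mathcal{G}^*$ has the common skeleton of the members of $\mathcal{G}$;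 an arrow $a\to b$ occurs in $\mathcal{G}^*$ iff $a\to b\in G'$ for at least one $G'\in\mathcal{G}$ but $a\leftarrow b\in G''$ for no $G''\in\mathcal{G}$; every other edge of the skeleton is a line in $\mathcal{G}^*$. Chain components. For a CG $G$, $\Xi(G)$ is the set of chain components: the (vertex sets of) connected components obtained by removing all arrows from $G$. A chain component $\xi$ is nontrivial if $|\xi|\ge2$. $\mathrm{pa}_G(A)$ (resp. $\mathrm{nb}_G(A)$) is the set of vertices $v\notin A$ with $v\to a\in G$ (resp. $v-a\in G$) for some $a\in A$. $\bar\xi=\xi\,\dot\cup\,\mathrm{pa}_G(\xi)$. $\Xi_s(G)$ is the set of nontrivial chain components $\xi$ of $G$ such that the induced subgraph $G_{\bar\xi}$ contains at least one chordless undirected cycle or flag. A line $a-b\in G$ is strong in $G$, written $a\overset{s}{-}b$, if $a,b\in\xi$ for some $\xi\in\Xi_s(G)$. Properties S and S$'$. For nonempty $\alpha\subseteq V$, the set of covering neighbors $\mathrm{cnb}_G(\alpha)$ (resp. covering parents $\mathrm{cpa}_G(\alpha)$) is the set of $v\notin\alpha$ with $v-a\in G$ (resp. $v\to a\in G$) for every $a\in\alpha$; the set of noncovering neighbors is $\mathrm{ncnb}_G(\alpha)=\mathrm{nb}_G(\alpha)\setminus\mathrm{cnb}_G(\alpha)$. Complete means pairwise adjacent. For a nontrivial chain component $\xi$, the following two properties of $G_{\bar\xi}$ are equivalent. S: for every nonempty complete subset $\alpha\subsetneq\xi$ such that $\kappa=\mathrm{cnb}_{G_\xi}(\alpha)$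 is nonempty, and for every connected component $\kappa_q$ of $G_\kappa$, either (i) $\mathrm{nb}_{G_\xi}(\kappa_q)\setminus\alpha\ne\varnothing$, or (ii) $\mathrm{pa}_{G_{\bar\xi}}(\alpha)\setminus\mathrm{cpa}_{G_{\bar\xi}}(\kappa_q)\neq\varnothing$. S$'$: for every nonempty connected subset $\kappa\subsetneq\xi$ such that $\alpha=\mathrm{cnb}_{G_\xi}(\kappa)$ is nonempty and complete, either (i$'$) $\mathrm{ncnb}_{G_\xi}(\kappa)\ne\varnothing$, or (ii$'$) $\mathrm{pa}_{G_{\bar\xi}}(\alpha)\setminus\mathrm{cpa}_{G_{\bar\xi}}(\kappa)\neq\varnothing$. Well protected. An arrow $a\to b\in G$ is well protected in $G$ if it occurs in at least one of the following eight configurations as an induced subgraph of $G$ (on the indicated vertices; pairs not listed as adjacent are nonadjacent): (i) $c\to a\to b$, $c,b$ nonadjacent; (ii) $a\to b\leftarrow c$, $a,c$ nonadjacent; (iii) $a\to b$, $a\to c$, $c\to b$; (iv) $a\to b$, $c\to b$, $d\to b$, $a-c$, $a-d$, with $c,d$ distinct and nonadjacent; (v) $a\to b$, $c\to b$, $a\overset{s}{-}c$; (vi) $c\overset{s}{-}a\to b$, $c,b$ nonadjacent; (vii) $a\to b\overset{s}{-}c$, $a,c$ nonadjacent; (viii) $a\to b$, $a\to c$, $b\overset{s}{-}c$.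
   Formalization: In the definition of Ξ_s(G), the chordless undirected cycle or flag in the induced subgraph on ξ̄ is required to contain a vertex of ξ; if ones lying wholly inside pa(ξ) counted, the characterization would be false. *)

theory Defs
  imports Main
begin

text \<open>
  Mixed graphs are encoded as a vertex set together with a set of ordered pairs:
  a line \<open>a - b\<close> is present as both \<open>(a, b)\<close> and \<open>(b, a)\<close>, an arrow \<open>a \<rightarrow> b\<close> as
  \<open>(a, b)\<close> alone.  Hence there is at most one edge between two vertices, and
  \<open>a \<Rightarrow> b\<close> (arrow or line) is just \<open>(a, b) \<in> edges G\<close>.
\<close>

record 'a mixed_graph =
  verts :: "'a set"
  edges :: "('a \<times> 'a) set"

definition graph :: "'a mixed_graph \<Rightarrow> bool" where
  "graph G \<longleftrightarrow> finite (verts G) \<and> edges G \<subseteq> verts G \<times> verts G \<and> irrefl (edges G)"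

definition arrow :: "'a mixed_graph \<Rightarrow> 'a \<Rightarrow> 'a \<Rightarrow> bool" where
  "arrow G a b \<longleftrightarrow> (a, b) \<in> edges G \<and> (b, a) \<notin> edges G"

definition line :: "'a mixed_graph \<Rightarrow> 'a \<Rightarrow> 'a \<Rightarrow> bool" where
  "line G a b \<longleftrightarrow> (a, b) \<in> edges G \<and> (b, a) \<in> edges G"

definition adjacent :: "'a mixed_graph \<Rightarrow> 'a \<Rightarrow> 'a \<Rightarrow> bool" where
  "adjacent G a b \<longleftrightarrow> (a, b) \<in> edges G \<or> (b, a) \<in> edges G"

definition nonadjacent :: "'a mixed_graph \<Rightarrow> 'a \<Rightarrow> 'a \<Rightarrow> bool" where
  "nonadjacent G a b \<longleftrightarrow> a \<in> verts G \<and> b \<in> verts G \<and> a \<noteq> b \<and> \<not> adjacent G a b"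

definition induced :: "'a mixed_graph \<Rightarrow> 'a set \<Rightarrow> 'a mixed_graph" where
  "induced G A = \<lparr>verts = verts G \<inter> A, edges = edges G \<inter> (A \<times> A)\<rparr>"

definition skeleton :: "'a mixed_graph \<Rightarrow> 'a mixed_graph" where
  "skeleton G = \<lparr>verts = verts G, edges = edges G \<union> (edges G)\<inverse>\<rparr>"

text \<open>
  The list \<open>vs\<close> holds \<open>v\<^sub>0, \<dots>, v\<^sub>k\<^sub>-\<^sub>1\<close>; the closing vertex \<open>v\<^sub>k = v\<^sub>0\<close> is implicit.
\<close>

definition cycle :: "'a mixed_graph \<Rightarrow> 'a list \<Rightarrow> bool" where
  "cycle G vs \<longleftrightarrow> length vs \<ge> 3 \<and> distinct vs \<and> set vs \<subseteq> verts G \<and>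
     (\<forall>i < length vs. (vs ! i, vs ! (Suc i mod length vs)) \<in> edges G)"

definition semi_directed_cycle :: "'a mixed_graph \<Rightarrow> 'a list \<Rightarrow> bool" where
  "semi_directed_cycle G vs \<longleftrightarrow> cycle G vs \<and>
     (\<exists>i < length vs. arrow G (vs ! i) (vs ! (Suc i mod length vs)))"

definition undirected_cycle :: "'a mixed_graph \<Rightarrow> 'a list \<Rightarrow> bool" where
  "undirected_cycle G vs \<longleftrightarrow> cycle G vs \<and>
     (\<forall>i < length vs. line G (vs ! i) (vs ! (Suc i mod length vs)))"

definition chordless_undirected_cycle :: "'a mixed_graph \<Rightarrow> 'a list \<Rightarrow> bool" where
  "chordless_undirected_cycle G vs \<longleftrightarrow> undirected_cycle G vs \<and> length vs \<ge> 4 \<and>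
     (\<forall>i < length vs. \<forall>j < length vs.
        i \<noteq> j \<and> j \<noteq> Suc i mod length vs \<and> i \<noteq> Suc j mod length vs \<longrightarrow>
        \<not> adjacent G (vs ! i) (vs ! j))"

definition adicyclic :: "'a mixed_graph \<Rightarrow> bool" where
  "adicyclic G \<longleftrightarrow> (\<nexists>vs. semi_directed_cycle G vs)"

definition chain_graph :: "'a mixed_graph \<Rightarrow> bool" where
  "chain_graph G \<longleftrightarrow> graph G \<and> adicyclic G"

definition immorality :: "'a mixed_graph \<Rightarrow> 'a \<Rightarrow> 'a \<Rightarrow> 'a \<Rightarrow> bool" where
  "immorality G a b c \<longleftrightarrow> nonadjacent G a c \<and> arrow G a b \<and> arrow G c b"

definition flag :: "'a mixed_graph \<Rightarrow> 'a \<Rightarrow> 'a \<Rightarrow> 'a \<Rightarrow> bool" where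
  "flag G a b c \<longleftrightarrow> nonadjacent G a c \<and> arrow G a b \<and> line G b c"

definition triplexes :: "'a mixed_graph \<Rightarrow> ('a set \<times> 'a) set" where
  "triplexes G = {({a, c}, b) | a b c. immorality G a b c \<or> flag G a b c \<or> flag G c b a}"

text \<open>
  AMP Markov equivalence is defined by the graphical criterion of Andersson, Madigan
  and Perlman.  Equality of skeletons includes equality of the vertex sets.
\<close>

definition amp_markov_equivalent :: "'a mixed_graph \<Rightarrow> 'a mixed_graph \<Rightarrow> bool" where
  "amp_markov_equivalent G H \<longleftrightarrow> skeleton G = skeleton H \<and> triplexes G = triplexes H"

definition amp_equivalence_class :: "'a mixed_graph set \<Rightarrow> bool" where
  "amp_equivalence_class C \<longleftrightarrow>
     (\<exists>G. chain_graph G \<and> C = {H. chain_graph H \<and> amp_markov_equivalent G H})"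

definition essential_arrow :: "'a mixed_graph set \<Rightarrow> 'a \<Rightarrow> 'a \<Rightarrow> bool" where
  "essential_arrow C a b \<longleftrightarrow> (\<exists>G\<in>C. arrow G a b) \<and> \<not> (\<exists>G\<in>C. arrow G b a)"

text \<open>
  All members of an equivalence class have the same vertices and the same adjacencies,
  so the unions below just denote the common ones.
\<close>

definition essential_graph :: "'a mixed_graph set \<Rightarrow> 'a mixed_graph" where
  "essential_graph C =
     \<lparr>verts = (\<Union>G\<in>C. verts G),
      edges = {(a, b). essential_arrow C a b} \<union>
              {(a, b). (\<exists>G\<in>C. adjacent G a b) \<and>
                       \<not> essential_arrow C a b \<and> \<not> essential_arrow C b a}\<rparr>"

definition is_amp_essential_graph :: "'a mixed_graph \<Rightarrow> bool" where
  "is_amp_essential_graph G \<longleftrightarrow> (\<exists>C. amp_equivalence_class C \<and> G = essential_graph C)"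

definition connectivity :: "'a mixed_graph \<Rightarrow> ('a \<times> 'a) set" where
  "connectivity G = {(a, b). a \<in> verts G \<and> b \<in> verts G \<and> (adjacent G)\<^sup>*\<^sup>* a b}"

definition connected_components :: "'a mixed_graph \<Rightarrow> 'a set set" where
  "connected_components G = verts G // connectivity G"

definition connected_in :: "'a mixed_graph \<Rightarrow> 'a set \<Rightarrow> bool" where
  "connected_in G A \<longleftrightarrow> (\<forall>a\<in>A. \<forall>b\<in>A. (a, b) \<in> connectivity (induced G A))"

definition remove_arrows :: "'a mixed_graph \<Rightarrow> 'a mixed_graph" where
  "remove_arrows G = \<lparr>verts = verts G, edges = {(a, b). line G a b}\<rparr>"

definition chain_components :: "'a mixed_graph \<Rightarrow> 'a set set" where
  "chain_components G = connected_components (remove_arrows G)"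

definition complete_in :: "'a mixed_graph \<Rightarrow> 'a set \<Rightarrow> bool" where
  "complete_in G A \<longleftrightarrow> (\<forall>a\<in>A. \<forall>b\<in>A. a \<noteq> b \<longrightarrow> adjacent G a b)"

definition pa :: "'a mixed_graph \<Rightarrow> 'a set \<Rightarrow> 'a set" where
  "pa G A = {v \<in> verts G - A. \<exists>a\<in>A. arrow G v a}"

definition nb :: "'a mixed_graph \<Rightarrow> 'a set \<Rightarrow> 'a set" where
  "nb G A = {v \<in> verts G - A. \<exists>a\<in>A. line G v a}"

definition cpa :: "'a mixed_graph \<Rightarrow> 'a set \<Rightarrow> 'a set" where
  "cpa G A = {v \<in> verts G - A. \<forall>a\<in>A. arrow G v a}"

definition cnb :: "'a mixed_graph \<Rightarrow> 'a set \<Rightarrow> 'a set" where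
  "cnb G A = {v \<in> verts G - A. \<forall>a\<in>A. line G v a}"

definition ncnb :: "'a mixed_graph \<Rightarrow> 'a set \<Rightarrow> 'a set" where
  "ncnb G A = nb G A - cnb G A"

definition parent_closure :: "'a mixed_graph \<Rightarrow> 'a set \<Rightarrow> 'a set" where
  "parent_closure G \<xi> = \<xi> \<union> pa G \<xi>"

text \<open>
  The cycle or flag must meet \<open>\<xi>\<close>.  A cycle or flag of the subgraph induced by
  \<open>\<xi> \<union> pa G \<xi>\<close> that lies entirely within \<open>pa G \<xi>\<close> says nothing about the lines in \<open>\<xi>\<close>;
  if such ones counted, the characterization would fail, for example for the
  essential graph with arrows \<open>p \<rightarrow> q\<close>, \<open>p \<rightarrow> x\<close>, \<open>p \<rightarrow> y\<close>, \<open>q \<rightarrow> x\<close>, \<open>q \<rightarrow> y\<close>, \<open>r \<rightarrow> x\<close>,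
  \<open>r \<rightarrow> y\<close> and lines \<open>q - r\<close>, \<open>q - s\<close>, \<open>x - y\<close>: the flag \<open>p \<rightarrow> q - r\<close> lies within the
  parents of \<open>{x, y}\<close>, which does not have property S.
\<close>

definition strong_chain_components :: "'a mixed_graph \<Rightarrow> 'a set set" where
  "strong_chain_components G = {\<xi> \<in> chain_components G. card \<xi> \<ge> 2 \<and>
     ((\<exists>vs. chordless_undirected_cycle (induced G (parent_closure G \<xi>)) vs \<and>
           set vs \<inter> \<xi> \<noteq> {}) \<or>
      (\<exists>a b c. flag (induced G (parent_closure G \<xi>)) a b c \<and> {a, b, c} \<inter> \<xi> \<noteq> {}))}"

definition strong_line :: "'a mixed_graph \<Rightarrow> 'a \<Rightarrow> 'a \<Rightarrow> bool" where
  "strong_line G a b \<longleftrightarrow> line G a b \<and> (\<exists>\<xi>\<in>strong_chain_components G. a \<in> \<xi> \<and> b \<in> \<xi>)"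

definition property_S :: "'a mixed_graph \<Rightarrow> 'a set \<Rightarrow> bool" where
  "property_S G \<xi> \<longleftrightarrow>
     (\<forall>\<alpha> \<kappa>. \<alpha> \<noteq> {} \<and> \<alpha> \<subset> \<xi> \<and> complete_in G \<alpha> \<and> \<kappa> = cnb (induced G \<xi>) \<alpha> \<and> \<kappa> \<noteq> {} \<longrightarrow>
        (\<forall>\<kappa>q \<in> connected_components (induced G \<kappa>).
           nb (induced G \<xi>) \<kappa>q - \<alpha> \<noteq> {} \<or>
           pa (induced G (parent_closure G \<xi>)) \<alpha> -
             cpa (induced G (parent_closure G \<xi>)) \<kappa>q \<noteq> {}))"

definition property_S' :: "'a mixed_graph \<Rightarrow> 'a set \<Rightarrow> bool" where
  "property_S' G \<xi> \<longleftrightarrow>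
     (\<forall>\<kappa> \<alpha>. \<kappa> \<noteq> {} \<and> \<kappa> \<subset> \<xi> \<and> connected_in G \<kappa> \<and>
            \<alpha> = cnb (induced G \<xi>) \<kappa> \<and> \<alpha> \<noteq> {} \<and> complete_in G \<alpha> \<longrightarrow>
        ncnb (induced G \<xi>) \<kappa> \<noteq> {} \<or>
        pa (induced G (parent_closure G \<xi>)) \<alpha> -
          cpa (induced G (parent_closure G \<xi>)) \<kappa> \<noteq> {})"

text \<open>
  In each disjunct the edges not listed are excluded by nonadjacency, and distinctness
  of the vertices involved follows from irreflexivity and from \<open>nonadjacent\<close>.
\<close>

definition well_protected :: "'a mixed_graph \<Rightarrow> 'a \<Rightarrow> 'a \<Rightarrow> bool" where
  "well_protected G a b \<longleftrightarrow> arrow G a b \<and>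
     ((\<exists>c. arrow G c a \<and> nonadjacent G c b) \<or>
      (\<exists>c. arrow G c b \<and> nonadjacent G a c) \<or>
      (\<exists>c. arrow G a c \<and> arrow G c b) \<or>
      (\<exists>c d. arrow G c b \<and> arrow G d b \<and> line G a c \<and> line G a d \<and> nonadjacent G c d) \<or>
      (\<exists>c. arrow G c b \<and> strong_line G a c) \<or>
      (\<exists>c. strong_line G c a \<and> nonadjacent G c b) \<or>
      (\<exists>c. strong_line G b c \<and> nonadjacent G a c) \<or>
      (\<exists>c. arrow G a c \<and> strong_line G b c))"

end

theory Submission
  imports Defs
begin

text \<open>
  If \<open>G\<close> satisfies G1--G3 and \<open>H\<close> is equivalent to \<open>G\<close>, then the strong lines of \<open>G\<close> are lines
  in \<open>H\<close> by property S', and no arrow of \<open>G\<close> is reversed in \<open>H\<close>, by induction on its head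
  (upwards) and its tail (downwards).  A component that is not strong is chordal with common parents
  for all its vertices, so a perfect ordering of it shows that each of its lines can be oriented
  either way within the class.  Hence \<open>G\<close> is the essential graph of its own class.

  Conversely, every class has a member that satisfies G1--G3, and by the above it is the essential
  graph of the class: as long as property S' fails for a strong component, this component can be
  split, which decreases the number of strong lines; as long as an arrow is not well protected, the
  two components that it joins can be merged, which creates no strong lines and decreases the
  number of arrows.
\<close>

section \<open>Chain graphs and rank functions\<close>

text \<open>Adicyclicity is awkward to re-establish by inspecting cycles after a graph has been
  modified. Therefore every chain graph is paired with a rank function that increases strictly along
  arrows and is constant on lines; for adjacent vertices the ranks then decide the orientation, and
  each modified graph is certified by an explicit new rank. The descent to a good member needs
  control of strength across the class. Chordless undirected cycles are common to all members, so
  strength can only change through flags. A split creates arrows only into a component that was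
  strong already, and a merged component has common parents, hence no flags. Rigidity of arrows is
  harder than that of strong lines: an equivalent graph may turn an arrow into a line, so the
  induction can only exclude reversals, and every configuration must be refuted from this weaker
  information.\<close>

text \<open>Prefixes and suffixes of a walk of minimal length can be glued at a repeated vertex or
  across a shortcut, which would give a shorter walk. The absence of shortcuts is what later makes
  cycles chordless.\<close>

lemma shortest_path:
  assumes "Q\<^sup>*\<^sup>* s t"
  obtains n p where "p 0 = s" "p n = t" "\<And>i. i < n \<Longrightarrow> Q (p i) (p (Suc i))"
    "\<And>i j. i < j \<Longrightarrow> j \<le> n \<Longrightarrow> p i \<noteq> p j"
    "\<And>i j. Suc i < j \<Longrightarrow> j \<le> n \<Longrightarrow> \<not> Q (p i) (p j)"
proof -
  define n where "n = (LEAST n. (Q ^^ n) s t)"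
  have ex: "\<exists>n. (Q ^^ n) s t" using assms by (rule rtranclp_imp_relpowp)
  have n: "(Q ^^ n) s t" unfolding n_def by (rule LeastI_ex[OF ex])
  have least: "n \<le> m" if "(Q ^^ m) s t" for m
    unfolding n_def by (rule Least_le[of "\<lambda>n. (Q ^^ n) s t", OF that])
  obtain p where p: "p 0 = s" "p n = t" "\<forall>i<n. Q (p i) (p (Suc i))"
    using n unfolding relpowp_fun_conv by blast
  have pre: "(Q ^^ i) s (p i)" if "i \<le> n" for i
    using that p by (auto simp: relpowp_fun_conv)
  have post: "(Q ^^ (n - j)) (p j) t" if "j \<le> n" for j
    unfolding relpowp_fun_conv using that p
    by (intro exI[of _ "\<lambda>k. p (k + j)"]) (auto simp: less_diff_conv)
  have "p i \<noteq> p j" if "i < j" "j \<le> n" for i j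
  proof
    assume "p i = p j"
    then have "(Q ^^ (i + (n - j))) s t"
      using pre[of i] post[of j] that unfolding relpowp_add by auto
    from least[OF this] that show False by simp
  qed
  moreover have "\<not> Q (p i) (p j)" if "Suc i < j" "j \<le> n" for i j
  proof
    assume "Q (p i) (p j)"
    then have "(Q ^^ Suc i) s (p j)"
      using pre[of i] that by auto
    then have "(Q ^^ (Suc i + (n - j))) s t"
      using post[of j] that unfolding relpowp_add by blast
    from least[OF this] that show False by simp
  qed
  ultimately show thesis using that p by blast
qed

text \<open>A line contributes both ordered pairs, so \<open>rank_le\<close> already makes the rank
  constant on lines.\<close>

locale ranked =
  fixes G :: "'a mixed_graph" and f :: "'a \<Rightarrow> nat"
  assumes graph: "graph G"
    and rank_le: "(a, b) \<in> edges G \<Longrightarrow> f a \<le> f b"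
    and rank_less: "arrow G a b \<Longrightarrow> f a < f b"

lemma line_sym: "line G a b \<longleftrightarrow> line G b a"
  by (auto simp: line_def)

lemma adjacent_sym: "adjacent G a b \<longleftrightarrow> adjacent G b a"
  by (auto simp: adjacent_def)

lemma line_imp_adjacent: "line G a b \<Longrightarrow> adjacent G a b"
  by (auto simp: line_def adjacent_def)

lemma arrow_imp_adjacent: "arrow G a b \<Longrightarrow> adjacent G a b"
  by (auto simp: arrow_def adjacent_def)

lemma lines_sym: "(line G)\<^sup>*\<^sup>* a b \<Longrightarrow> (line G)\<^sup>*\<^sup>* b a"
  by (metis line_sym sympD sympI symp_rtranclp)

lemma graph_verts: "graph G \<Longrightarrow> (a, b) \<in> edges G \<Longrightarrow> a \<in> verts G \<and> b \<in> verts G \<and> a \<noteq> b"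
  by (auto simp: graph_def irrefl_def)

lemma graph_adjacent: "graph G \<Longrightarrow> adjacent G a b \<Longrightarrow> a \<in> verts G \<and> b \<in> verts G \<and> a \<noteq> b"
  by (auto simp: adjacent_def dest: graph_verts)

lemma nonadjacentI:
  "a \<in> verts G \<Longrightarrow> b \<in> verts G \<Longrightarrow> a \<noteq> b \<Longrightarrow> \<not> adjacent G a b \<Longrightarrow> nonadjacent G a b"
  by (simp add: nonadjacent_def)

lemma nonadjacent_sym: "nonadjacent G a b \<longleftrightarrow> nonadjacent G b a"
  by (auto simp: nonadjacent_def adjacent_sym)

text \<open>Around a cycle the rank never drops and returns to its start, so it is constant and no
  edge of the cycle is an arrow.\<close>

lemma ranked_imp_chain_graph:
  assumes "ranked G f"
  shows "chain_graph G"
proof -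
  interpret ranked G f by fact
  have False if "semi_directed_cycle G vs" for vs
  proof -
    let ?n = "length vs"
    from that obtain i where n: "?n \<ge> 3"
      and e: "\<And>i. i < ?n \<Longrightarrow> (vs ! i, vs ! (Suc i mod ?n)) \<in> edges G"
      and i: "i < ?n" "arrow G (vs ! i) (vs ! (Suc i mod ?n))"
      by (auto simp: semi_directed_cycle_def cycle_def)
    have up: "f (vs ! j) \<le> f (vs ! k)" if "j \<le> k" "k < ?n" for j k
      using that
    proof (induction k rule: dec_induct)
      case (step m)
      have "f (vs ! m) \<le> f (vs ! Suc m)"
        using rank_le[OF e[of m]] step.prems by simp
      with step show ?case by simp
    qed simp
    have "?n - 1 < ?n" "Suc (?n - 1) = ?n" using n by auto
    then have "f (vs ! (?n - 1)) \<le> f (vs ! 0)"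
      using rank_le[OF e[of "?n - 1"]] by simp
    with \<open>?n - 1 < ?n\<close> have "f (vs ! j) = f (vs ! 0)" if "j < ?n" for j
      using up[of 0 j] up[of j "?n - 1"] that \<open>?n - 1 < ?n\<close> by fastforce
    moreover have "Suc i mod ?n < ?n" using i(1) by (intro mod_less_divisor) linarith
    ultimately show False using rank_less[OF i(2)] i(1) by simp
  qed
  then show ?thesis by (auto simp: chain_graph_def adicyclic_def graph)
qed

text \<open>The rank of a vertex is the number of vertices from which it can be reached. An arrow
  \<open>a\<close> to \<open>b\<close> raises it because \<open>b\<close> itself is counted for
  \<open>b\<close> but not for \<open>a\<close>: a shortest way back from \<open>b\<close> to
  \<open>a\<close> would close up to a semi-directed cycle.\<close>

lemma chain_graph_ranked:
  assumes "chain_graph G"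
  obtains f where "ranked G f"
proof -
  have g: "graph G" using assms by (simp add: chain_graph_def)
  let ?E = "\<lambda>a b. (a, b) \<in> edges G"
  have no_return: "\<not> ?E\<^sup>*\<^sup>* b a" if "arrow G a b" for a b
  proof
    assume "?E\<^sup>*\<^sup>* b a"
    then obtain n p where p: "p 0 = b" "p n = a" "\<And>i. i < n \<Longrightarrow> ?E (p i) (p (Suc i))"
      "\<And>i j. i < j \<Longrightarrow> j \<le> n \<Longrightarrow> p i \<noteq> p j"
      by (rule shortest_path) blast
    have ab: "a \<noteq> b" "\<not> ?E b a" "a \<in> verts G"
      using that graph_verts[OF g] by (auto simp: arrow_def)
    have "n \<noteq> 0" using ab p(1,2) by (intro notI) simp
    moreover have "n \<noteq> 1" using ab p(1,2) p(3)[of 0] by (intro notI) simp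
    \<comment> \<open>The path has \<open>n + 1\<close> vertices, so this is the bound 3 on the
      length of a cycle.\<close>
    ultimately have n: "n \<ge> 2" by simp
    let ?vs = "map p [0..<Suc n]"
    have nth: "?vs ! i = p i" if "i \<le> n" for i
      using that by (metis add_0 diff_zero le_imp_less_Suc length_upt nth_map nth_upt)
    have dist: "distinct ?vs"
      unfolding distinct_map inj_on_def using p(4)
      by (metis atLeastLessThan_iff distinct_upt less_Suc_eq_le linorder_neqE_nat set_upt)
    have "p i \<in> verts G" if "i \<le> n" for i
      using that p(2) p(3)[of i] graph_verts[OF g] ab(3) by (cases "i = n") auto
    then have sub: "set ?vs \<subseteq> verts G" by auto
    have "(?vs ! i, ?vs ! (Suc i mod length ?vs)) \<in> edges G" if "i < length ?vs" for i
    proof (cases "i = n")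
      case True
      then show ?thesis using nth[of n] nth[of 0] p that \<open>arrow G a b\<close>
        by (simp add: arrow_def del: upt_Suc)
    next
      case False
      then have "i < n" using that by simp
      then show ?thesis using nth[of i] nth[of "Suc i"] p(3)[of i] by (simp del: upt_Suc)
    qed
    then have "cycle G ?vs" unfolding cycle_def using n dist sub by simp
    moreover have "arrow G (?vs ! n) (?vs ! (Suc n mod length ?vs))"
      using nth[of n] nth[of 0] p \<open>arrow G a b\<close> by (simp del: upt_Suc)
    moreover have "n < length ?vs" by simp
    ultimately have "semi_directed_cycle G ?vs"
      unfolding semi_directed_cycle_def by blast
    with assms show False by (auto simp: chain_graph_def adicyclic_def)
  qed
  define f where "f a = card {c \<in> verts G. ?E\<^sup>*\<^sup>* c a}" for a
  have fin: "finite {c \<in> verts G. ?E\<^sup>*\<^sup>* c a}" for a using g by (simp add: graph_def)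
  have "ranked G f"
  proof
    show "f a \<le> f b" if "?E a b" for a b
      unfolding f_def using that by (intro card_mono fin) (auto intro: rtranclp.rtrancl_into_rtrancl)
    show "f a < f b" if "arrow G a b" for a b
      unfolding f_def
    proof (intro psubset_card_mono fin psubsetI)
      have ab: "?E a b" using that by (simp add: arrow_def)
      show "{c \<in> verts G. ?E\<^sup>*\<^sup>* c a} \<subseteq> {c \<in> verts G. ?E\<^sup>*\<^sup>* c b}"
        using ab by (auto intro: rtranclp.rtrancl_into_rtrancl)
      show "{c \<in> verts G. ?E\<^sup>*\<^sup>* c a} \<noteq> {c \<in> verts G. ?E\<^sup>*\<^sup>* c b}"
        using no_return[OF that] graph_verts[OF g ab] by blast
    qed
  qed (rule g)
  then show thesis by (rule that)
qed

context ranked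
begin

lemma rank_line: "line G a b \<Longrightarrow> f a = f b"
  using rank_le[of a b] rank_le[of b a] by (auto simp: line_def)

lemma rank_lines: "(line G)\<^sup>*\<^sup>* a b \<Longrightarrow> f a = f b"
  by (induction rule: rtranclp_induct) (auto dest: rank_line)

lemma adjacent_rank_eq: "adjacent G a b \<Longrightarrow> f a = f b \<Longrightarrow> line G a b"
  using rank_less[of a b] rank_less[of b a] by (auto simp: adjacent_def arrow_def line_def)

lemma adjacent_rank_less: "adjacent G a b \<Longrightarrow> f a < f b \<Longrightarrow> arrow G a b"
  using rank_le[of b a] by (auto simp: adjacent_def arrow_def)

lemma lines_verts: "(line G)\<^sup>*\<^sup>* a b \<Longrightarrow> a \<in> verts G \<Longrightarrow> b \<in> verts G"
  by (induction rule: rtranclp_induct) (auto simp: line_def dest: graph_verts[OF graph])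

end

section \<open>Triplexes and Markov equivalence\<close>

text \<open>Immoralities and both kinds of flags in one formula: neither edge is an arrow out of
  \<open>b\<close>, and not both are lines. Proofs then argue about membership in
  \<open>edges\<close> without splitting into three cases.\<close>

definition triplex :: "'a mixed_graph \<Rightarrow> 'a \<Rightarrow> 'a \<Rightarrow> 'a \<Rightarrow> bool" where
  "triplex G a b c \<longleftrightarrow> nonadjacent G a c \<and> (a, b) \<in> edges G \<and> (c, b) \<in> edges G \<and>
     \<not> (line G a b \<and> line G b c)"

lemma triplexes_eq: "triplexes G = {({a, c}, b) | a b c. triplex G a b c}"
  unfolding triplexes_def
proof (intro set_eqI iffI; clarify)
  show "\<exists>a' b' c'. ({a, c}, b) = ({a', c'}, b') \<and> triplex G a' b' c'"
    if "immorality G a b c \<or> flag G a b c \<or> flag G c b a" for a b c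
    using that
    by (intro exI[of _ a] exI[of _ b] exI[of _ c])
      (auto simp: immorality_def flag_def triplex_def arrow_def line_def nonadjacent_def adjacent_def)
  show "\<exists>a' b' c'. ({a, c}, b) = ({a', c'}, b') \<and>
      (immorality G a' b' c' \<or> flag G a' b' c' \<or> flag G c' b' a')"
    if "triplex G a b c" for a b c
    using that
    by (intro exI[of _ a] exI[of _ b] exI[of _ c])
      (auto simp: immorality_def flag_def triplex_def arrow_def line_def nonadjacent_def adjacent_def)
qed

lemma triplex_sym: "triplex G a b c \<longleftrightarrow> triplex G c b a"
  by (auto simp: triplex_def nonadjacent_sym line_sym)

lemma amp_markov_equivalent_iff:
  "amp_markov_equivalent G H \<longleftrightarrow>
     verts G = verts H \<and> adjacent G = adjacent H \<and> triplex G = triplex H"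
proof -
  have "skeleton G = skeleton H \<longleftrightarrow> verts G = verts H \<and> adjacent G = adjacent H"
    by (auto simp: skeleton_def adjacent_def fun_eq_iff)
  moreover have "triplexes G = triplexes H \<longleftrightarrow> triplex G = triplex H"
  proof
    assume *: "triplexes G = triplexes H"
    have "triplex G a b c \<longleftrightarrow> ({a, c}, b) \<in> triplexes G" for G :: "'a mixed_graph" and a b c
      unfolding triplexes_eq using triplex_sym[of G] by (auto simp: doubleton_eq_iff)
    then show "triplex G = triplex H" using * by (simp add: fun_eq_iff)
  qed (simp add: triplexes_eq)
  ultimately show ?thesis by (auto simp: amp_markov_equivalent_def)
qed

lemma nonadjacent_cong:
  "verts G = verts H \<Longrightarrow> adjacent G = adjacent H \<Longrightarrow> nonadjacent G = nonadjacent H"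
  by (simp add: nonadjacent_def fun_eq_iff)

text \<open>
  A vertex of maximal rank on the cycle has a predecessor of the same rank, as otherwise
  there would be a triplex at it.
\<close>

lemma (in ranked) chordless_undirected_cycle_equivalent:
  assumes eq: "amp_markov_equivalent G H" and c: "chordless_undirected_cycle H vs"
  shows "chordless_undirected_cycle G vs"
proof -
  let ?n = "length vs"
  have V: "verts G = verts H" and adj: "adjacent G = adjacent H" and trip: "triplex G = triplex H"
    using eq by (auto simp: amp_markov_equivalent_iff)
  have n: "?n \<ge> 4" and d: "distinct vs" and sub: "set vs \<subseteq> verts G"
    and l: "\<And>i. i < ?n \<Longrightarrow> line H (vs ! i) (vs ! (Suc i mod ?n))"
    and ch: "\<And>i j. i < ?n \<Longrightarrow> j < ?n \<Longrightarrow> i \<noteq> j \<Longrightarrow> j \<noteq> Suc i mod ?n \<Longrightarrow> i \<noteq> Suc j mod ?n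
      \<Longrightarrow> \<not> adjacent G (vs ! i) (vs ! j)"
    using c V adj
    by (auto simp: chordless_undirected_cycle_def undirected_cycle_def cycle_def)
  have lt: "k mod ?n < ?n" for k using n by (intro mod_less_divisor) linarith
  \<comment> \<open>Periodic extension of the cycle, so that passing to a neighbour needs no
    wrap-around.\<close>
  define q where "q k = vs ! (k mod ?n)" for k
  have lq: "line H (q k) (q (Suc k))" for k
  proof -
    from l[OF lt] show ?thesis by (simp add: q_def mod_Suc_eq)
  qed
  have aq: "adjacent G (q k) (q (Suc k))" for k
    using lq adj line_imp_adjacent by metis
  have qV: "q k \<in> verts G" for k
    unfolding q_def by (intro subsetD[OF sub] nth_mem lt)
  have nq: "nonadjacent G (q k) (q (Suc (Suc k)))" for k
  proof -
    \<comment> \<open>The third inequality is where a length of at least 4 is needed: in a triangle,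
      \<open>k\<close> and \<open>k + 3\<close> coincide.\<close>
    have *: "k mod ?n \<noteq> Suc (Suc k) mod ?n" "Suc (Suc k) mod ?n \<noteq> Suc k mod ?n"
      "k mod ?n \<noteq> Suc (Suc (Suc k)) mod ?n"
      using n by (auto simp: mod_Suc split: if_splits)
    have "\<not> adjacent G (q k) (q (Suc (Suc k)))"
      unfolding q_def
      by (rule ch) (use lt * in \<open>simp_all add: mod_Suc_eq\<close>)
    moreover have "q k \<noteq> q (Suc (Suc k))"
      using * lt d by (simp add: q_def nth_eq_iff_index_eq)
    ultimately show ?thesis using qV by (simp add: nonadjacentI)
  qed
  define m where "m = Max (f ` set vs)"
  have "m \<in> f ` set vs" unfolding m_def using n by (intro Max_in) auto
  then obtain k0 where k0: "k0 < ?n" "f (vs ! k0) = m" by (auto simp: in_set_conv_nth)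
  have qm: "f (q k) \<le> m" for k
    unfolding m_def q_def by (intro Max_ge) (auto intro!: nth_mem lt)
  have pred: "f (q k) = m" if "f (q (Suc k)) = m" for k
  proof (rule ccontr)
    assume "f (q k) \<noteq> m"
    then have "f (q k) < f (q (Suc k))" using qm[of k] that by simp
    then have a: "arrow G (q k) (q (Suc k))" using aq by (rule adjacent_rank_less[rotated])
    have "(q (Suc (Suc k)), q (Suc k)) \<in> edges G"
      using aq[of "Suc k"] qm[of "Suc (Suc k)"] that rank_less[of "q (Suc k)" "q (Suc (Suc k))"]
      by (auto simp: arrow_def adjacent_def)
    with a nq have "triplex G (q k) (q (Suc k)) (q (Suc (Suc k)))"
      by (auto simp: triplex_def arrow_def line_def)
    then have "triplex H (q k) (q (Suc k)) (q (Suc (Suc k)))" using trip by simp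
    with lq show False by (auto simp: triplex_def)
  qed
  \<comment> \<open>\<open>pred\<close> only moves backwards, so the descent starts from the copy of
    \<open>k0\<close> one period later and thus reaches all indices of a full period.\<close>
  have "f (q j) = m" if "j \<le> k0 + ?n" for j
    using that
  proof (induction j rule: inc_induct)
    case base
    then show ?case using k0 by (simp add: q_def)
  qed (rule pred)
  then have fq: "f (q j) = m" if "j < ?n" for j using that by simp
  have "line G (vs ! i) (vs ! (Suc i mod ?n))" if "i < ?n" for i
  proof (rule adjacent_rank_eq)
    show "adjacent G (vs ! i) (vs ! (Suc i mod ?n))"
      using aq[of i] that by (simp add: q_def)
    show "f (vs ! i) = f (vs ! (Suc i mod ?n))"
      using fq[OF that] fq[OF lt[of "Suc i"]] that by (simp add: q_def)
  qed
  then show ?thesis using n d sub ch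
    by (auto simp: chordless_undirected_cycle_def undirected_cycle_def cycle_def line_def)
qed

section \<open>Strong vertices\<close>

text \<open>
  Membership in a strong chain component, phrased through the line-connectivity relation so that
  it can be compared between different graphs.
\<close>

definition strong_vertex :: "'a mixed_graph \<Rightarrow> 'a \<Rightarrow> bool" where
  "strong_vertex G x \<longleftrightarrow>
     (\<exists>vs v. chordless_undirected_cycle G vs \<and> v \<in> set vs \<and> (line G)\<^sup>*\<^sup>* v x) \<or>
     (\<exists>p b c. flag G p b c \<and> (line G)\<^sup>*\<^sup>* b x)"

definition line_component :: "'a mixed_graph \<Rightarrow> 'a \<Rightarrow> 'a set" where
  "line_component G x = {y. (line G)\<^sup>*\<^sup>* x y}"

lemma line_component_self: "x \<in> line_component G x"
  by (simp add: line_component_def)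

lemma line_component_line:
  "y \<in> line_component G x \<Longrightarrow> line G y z \<Longrightarrow> z \<in> line_component G x"
  by (auto simp: line_component_def)

lemma strong_vertex_lines: "strong_vertex G x \<Longrightarrow> (line G)\<^sup>*\<^sup>* x y \<Longrightarrow> strong_vertex G y"
  unfolding strong_vertex_def by (meson rtranclp_trans)

section \<open>Induced subgraphs and chordless cycles\<close>

lemma induced_simps:
  assumes "a \<in> A" "b \<in> A"
  shows "(a, b) \<in> edges (induced G A) \<longleftrightarrow> (a, b) \<in> edges G"
    "arrow (induced G A) a b \<longleftrightarrow> arrow G a b"
    "line (induced G A) a b \<longleftrightarrow> line G a b"
    "adjacent (induced G A) a b \<longleftrightarrow> adjacent G a b"
    "nonadjacent (induced G A) a b \<longleftrightarrow> nonadjacent G a b"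
  using assms by (auto simp: induced_def arrow_def line_def adjacent_def nonadjacent_def)

lemma verts_induced: "verts (induced G A) = verts G \<inter> A"
  by (simp add: induced_def)

lemma induced_edgesD:
  "line (induced G A) a b \<Longrightarrow> line G a b \<and> a \<in> A \<and> b \<in> A"
  "arrow (induced G A) a b \<Longrightarrow> arrow G a b \<and> a \<in> A \<and> b \<in> A"
  "adjacent (induced G A) a b \<Longrightarrow> adjacent G a b \<and> a \<in> A \<and> b \<in> A"
  by (auto simp: induced_def arrow_def line_def adjacent_def)

lemma chordless_undirected_cycle_induced:
  "chordless_undirected_cycle (induced G A) vs \<longleftrightarrow> chordless_undirected_cycle G vs \<and> set vs \<subseteq> A"
proof -
  have "chordless_undirected_cycle (induced G A) vs \<longleftrightarrow> chordless_undirected_cycle G vs"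
    if sub: "set vs \<subseteq> A"
  proof -
    have m: "vs ! i \<in> A" if "i < length vs" for i using that sub by (meson nth_mem subsetD)
    have m': "vs ! (Suc i mod length vs) \<in> A" if "i < length vs" for i
      using that by (intro m) (auto intro: mod_less_divisor)
    show ?thesis
      unfolding chordless_undirected_cycle_def undirected_cycle_def cycle_def
      using m m' sub by (simp add: induced_simps verts_induced cong: conj_cong)
  qed
  moreover have "set vs \<subseteq> A" if "chordless_undirected_cycle (induced G A) vs"
    using that by (auto simp: chordless_undirected_cycle_def undirected_cycle_def cycle_def verts_induced)
  ultimately show ?thesis by blast
qed

lemma chordless_undirected_cycle_lines:
  assumes c: "chordless_undirected_cycle G vs" and "u \<in> set vs" "v \<in> set vs"
  shows "(line G)\<^sup>*\<^sup>* u v"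
proof -
  have l: "line G (vs ! i) (vs ! (Suc i mod length vs))" if "i < length vs" for i
    using c that by (auto simp: chordless_undirected_cycle_def undirected_cycle_def)
  have *: "(line G)\<^sup>*\<^sup>* (vs ! 0) (vs ! i)" if "i < length vs" for i
    using that
  proof (induction i)
    case (Suc i)
    then show ?case using l[of i] by (auto intro: rtranclp.rtrancl_into_rtrancl)
  qed simp
  then show ?thesis using assms(2,3) unfolding in_set_conv_nth
    by (metis lines_sym rtranclp_trans)
qed

text \<open>On a cycle of length at least 4 the positions 0 and 2 are not consecutive. Such a pair
  is what turns a common neighbour into the middle of a triplex.\<close>

lemma chordless_not_adjacent:
  assumes "chordless_undirected_cycle G vs"
  shows "vs ! 0 \<in> set vs" "vs ! 2 \<in> set vs" "nonadjacent G (vs ! 0) (vs ! 2)"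
proof -
  have n: "length vs \<ge> 4" "distinct vs" "set vs \<subseteq> verts G"
    and ch: "\<And>i j. i < length vs \<Longrightarrow> j < length vs \<Longrightarrow> i \<noteq> j \<Longrightarrow> j \<noteq> Suc i mod length vs
        \<Longrightarrow> i \<noteq> Suc j mod length vs \<Longrightarrow> \<not> adjacent G (vs ! i) (vs ! j)"
    using assms by (auto simp: chordless_undirected_cycle_def undirected_cycle_def cycle_def)
  show m: "vs ! 0 \<in> set vs" "vs ! 2 \<in> set vs" using n by (auto intro!: nth_mem)
  show "nonadjacent G (vs ! 0) (vs ! 2)"
  proof (rule nonadjacentI)
    have "Suc 0 mod length vs = 1" "Suc 2 mod length vs = 3" using n by auto
    then show "\<not> adjacent G (vs ! 0) (vs ! 2)" using n by (intro ch) auto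
    have "0 < length vs" "2 < length vs" using n(1) by linarith+
    then show "vs ! 0 \<noteq> vs ! 2" using n by (simp add: nth_eq_iff_index_eq)
  qed (use m n in auto)
qed

section \<open>Strong components in terms of ranks and line-connectivity\<close>

context ranked
begin

lemma chain_components_iff:
  "\<xi> \<in> chain_components G \<longleftrightarrow> (\<exists>x\<in>verts G. \<xi> = line_component G x)"
proof -
  have "adjacent (remove_arrows G) = line G"
    by (auto simp: adjacent_def remove_arrows_def line_def fun_eq_iff)
  moreover have "verts (remove_arrows G) = verts G" by (simp add: remove_arrows_def)
  ultimately have "connectivity (remove_arrows G) `` {x} = line_component G x" if "x \<in> verts G" for x
    using that lines_verts by (auto simp: connectivity_def line_component_def)
  then show ?thesis
    by (auto simp: chain_components_def connected_components_def quotient_def remove_arrows_def)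
qed

lemma line_component_subset: "x \<in> verts G \<Longrightarrow> line_component G x \<subseteq> verts G"
  using lines_verts by (auto simp: line_component_def)

lemma line_component_rank: "y \<in> line_component G x \<Longrightarrow> f y = f x"
  by (auto simp: line_component_def dest: rank_lines)

text \<open>The component has the largest rank within its parent closure, so the tail
  \<open>a\<close> of the arrow lies strictly below it. A flag that meets the component therefore
  does so in \<open>b\<close> or \<open>c\<close>, and the line between these puts \<open>b\<close>
  into it.\<close>

lemma flag_in_closure:
  assumes x: "x \<in> verts G"
  shows "(flag (induced G (parent_closure G (line_component G x))) a b c
      \<and> {a, b, c} \<inter> line_component G x \<noteq> {}) \<longleftrightarrow>
    flag G a b c \<and> (line G)\<^sup>*\<^sup>* b x"
    (is "flag ?I a b c \<and> _ \<longleftrightarrow> _")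
proof
  assume "flag G a b c \<and> (line G)\<^sup>*\<^sup>* b x"
  then have fl: "nonadjacent G a c" "arrow G a b" "line G b c"
    and b: "b \<in> line_component G x" by (auto simp: flag_def line_component_def lines_sym)
  have c: "c \<in> line_component G x" using line_component_line[OF b fl(3)] .
  have "a \<notin> line_component G x"
    using rank_less[OF fl(2)] line_component_rank[of a x] line_component_rank[OF b] by auto
  then have "a \<in> pa G (line_component G x)"
    using fl b by (auto simp: pa_def nonadjacent_def)
  with b c fl show "flag ?I a b c \<and> {a, b, c} \<inter> line_component G x \<noteq> {}"
    by (auto simp: flag_def parent_closure_def induced_simps)
next
  assume *: "flag ?I a b c \<and> {a, b, c} \<inter> line_component G x \<noteq> {}"
  then have m: "a \<in> parent_closure G (line_component G x)" "b \<in> parent_closure G (line_component G x)"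
      "c \<in> parent_closure G (line_component G x)"
    using induced_edgesD unfolding flag_def by metis+
  then have fl: "nonadjacent G a c" "arrow G a b" "line G b c"
    using * by (auto simp: flag_def induced_simps)
  have "b \<in> line_component G x"
  proof -
    have "f d \<le> f x" if "d \<in> parent_closure G (line_component G x)" for d
      using that line_component_rank rank_less
      by (fastforce simp: parent_closure_def pa_def)
    then have "a \<notin> line_component G x"
      using rank_less[OF fl(2)] m(2) line_component_rank by fastforce
    moreover have "b \<in> line_component G x" if "c \<in> line_component G x"
      using line_component_line[OF that] fl(3) by (simp add: line_sym)
    ultimately show ?thesis using * by blast
  qed
  with fl show "flag G a b c \<and> (line G)\<^sup>*\<^sup>* b x"
    by (auto simp: flag_def line_component_def lines_sym)
qed

text \<open>An undirected cycle is connected by lines, so it lies inside the component as soon as it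
  meets it.\<close>

lemma chordless_cycle_in_closure:
  assumes x: "x \<in> verts G"
  shows "(chordless_undirected_cycle (induced G (parent_closure G (line_component G x))) vs
      \<and> set vs \<inter> line_component G x \<noteq> {}) \<longleftrightarrow>
    chordless_undirected_cycle G vs \<and> (\<exists>v\<in>set vs. (line G)\<^sup>*\<^sup>* v x)"
proof -
  have "set vs \<subseteq> parent_closure G (line_component G x)"
    if c: "chordless_undirected_cycle G vs" and v: "v \<in> set vs" "(line G)\<^sup>*\<^sup>* v x" for v
    using chordless_undirected_cycle_lines[OF c v(1)] v(2)
    by (auto simp: parent_closure_def line_component_def)
      (meson lines_sym rtranclp_trans)
  then show ?thesis
    unfolding chordless_undirected_cycle_induced
    by (auto simp: line_component_def lines_sym) (meson lines_sym)+
qed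

text \<open>The bound on the cardinality takes care of itself: a chordless cycle has two distinct
  vertices, and so has the line of a flag.\<close>

lemma strong_chain_components_iff:
  "\<xi> \<in> strong_chain_components G \<longleftrightarrow>
     (\<exists>x\<in>verts G. \<xi> = line_component G x \<and> strong_vertex G x)"
proof -
  have card: "card (line_component G x) \<ge> 2" if x: "x \<in> verts G" and s: "strong_vertex G x" for x
  proof -
    have "\<exists>u v. u \<noteq> v \<and> (line G)\<^sup>*\<^sup>* u x \<and> (line G)\<^sup>*\<^sup>* v x"
      using s unfolding strong_vertex_def
    proof (elim disjE exE conjE)
      fix vs v assume c: "chordless_undirected_cycle G vs" "v \<in> set vs" "(line G)\<^sup>*\<^sup>* v x"
      then have "(line G)\<^sup>*\<^sup>* u x" if "u \<in> set vs" for u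
        using chordless_undirected_cycle_lines[OF c(1) that c(2)] by simp
      then show ?thesis using chordless_not_adjacent[OF c(1)] by (auto simp: nonadjacent_def)
    next
      fix p b c assume "flag G p b c" "(line G)\<^sup>*\<^sup>* b x"
      then show ?thesis
        using graph_verts[OF graph, of b c] line_sym[of G b c]
        by (intro exI[of _ b] exI[of _ c])
          (auto simp: flag_def line_def intro: converse_rtranclp_into_rtranclp)
    qed
    then obtain u v where uv: "u \<noteq> v" "{u, v} \<subseteq> line_component G x"
      using lines_sym unfolding line_component_def by fast
    have "finite (line_component G x)"
      using line_component_subset[OF x] graph finite_subset by (auto simp: graph_def)
    from card_mono[OF this uv(2)] uv(1) show ?thesis by simp
  qed
  have "(\<exists>vs. chordless_undirected_cycle (induced G (parent_closure G (line_component G x))) vs \<and>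
           set vs \<inter> line_component G x \<noteq> {}) \<or>
      (\<exists>a b c. flag (induced G (parent_closure G (line_component G x))) a b c
        \<and> {a, b, c} \<inter> line_component G x \<noteq> {}) \<longleftrightarrow> strong_vertex G x"
    if "x \<in> verts G" for x
    unfolding flag_in_closure[OF that] chordless_cycle_in_closure[OF that] strong_vertex_def
    by (simp add: Bex_def)
  with card have "line_component G x \<in> strong_chain_components G \<longleftrightarrow> strong_vertex G x"
    if "x \<in> verts G" for x
    using that chain_components_iff by (auto simp: strong_chain_components_def)
  moreover have "\<xi> \<in> chain_components G" if "\<xi> \<in> strong_chain_components G"
    using that by (simp add: strong_chain_components_def)
  ultimately show ?thesis
    unfolding chain_components_iff by auto
qed

lemma strong_line_iff: "strong_line G a b \<longleftrightarrow> line G a b \<and> strong_vertex G a"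
proof -
  have "line G a b \<Longrightarrow> strong_vertex G a \<Longrightarrow> a \<in> verts G \<and> b \<in> line_component G a"
    using graph_verts[OF graph] by (auto simp: line_def line_component_def)
  moreover have "a \<in> line_component G x \<Longrightarrow> strong_vertex G x \<Longrightarrow> strong_vertex G a" for x
    using strong_vertex_lines by (auto simp: line_component_def)
  ultimately show ?thesis
    unfolding strong_line_def Bex_def strong_chain_components_iff
    by (metis line_component_self)
qed

text \<open>Without flags, a parent of one end of a line is adjacent to the other end, and its
  smaller rank orients that edge. Parenthood thus spreads along the lines.\<close>

lemma weak_common_parents:
  assumes weak: "\<not> strong_vertex G x" and b: "(line G)\<^sup>*\<^sup>* b x" and p: "arrow G p b"
    and c: "(line G)\<^sup>*\<^sup>* b c"
  shows "arrow G p c"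
  using c
proof (induction rule: rtranclp_induct)
  case base
  show ?case by fact
next
  case (step c d)
  have "(line G)\<^sup>*\<^sup>* c x" using lines_sym[OF step.hyps(1)] b by simp
  then have "\<not> flag G p c d" using weak unfolding strong_vertex_def by blast
  moreover have "p \<in> verts G" "d \<in> verts G"
    using p step.hyps(2) graph_verts[OF graph] by (auto simp: arrow_def line_def)
  moreover have "f p < f d" using rank_less[OF step.IH] rank_line[OF step.hyps(2)] by simp
  ultimately show ?case
    using step by (auto simp: flag_def nonadjacent_def intro: adjacent_rank_less)
qed

end

section \<open>Perfect orderings of chordal graphs\<close>

text \<open>Minimal separators of a chordal graph are complete. \<open>C\<close> is a connected set
  of non-neighbours of \<open>v\<close>, and \<open>s\<close>, \<open>t\<close> are neighbours of
  \<open>v\<close> that touch \<open>C\<close>. A shortest path from \<open>s\<close> to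
  \<open>t\<close> through \<open>C\<close>, closed up by \<open>v\<close>, is a chordless cycle
  unless \<open>s\<close> and \<open>t\<close> are joined.\<close>

lemma separator_complete:
  assumes nc: "\<And>vs. chordless_undirected_cycle G vs \<Longrightarrow> \<not> set vs \<subseteq> U"
    and U: "U \<subseteq> verts G" and adj: "\<And>x y. x \<in> U \<Longrightarrow> y \<in> U \<Longrightarrow> adjacent G x y \<Longrightarrow> line G x y"
    and C: "C \<subseteq> U" "v \<notin> C" "\<And>c. c \<in> C \<Longrightarrow> \<not> line G v c"
    and con: "\<And>c d. c \<in> C \<Longrightarrow> d \<in> C \<Longrightarrow> (\<lambda>x y. line G x y \<and> x \<in> C \<and> y \<in> C)\<^sup>*\<^sup>* c d"
    and v: "v \<in> U" and st: "s \<in> U" "t \<in> U" "s \<noteq> t" "v \<noteq> s" "v \<noteq> t" "line G v s" "line G v t"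
    and c: "c \<in> C" "line G s c" and d: "d \<in> C" "line G d t"
  shows "line G s t"
proof (rule ccontr)
  assume nst: "\<not> line G s t"
  let ?D = "insert s (insert t C)"
  let ?Q = "\<lambda>x y. line G x y \<and> x \<in> ?D \<and> y \<in> ?D"
  have "?Q\<^sup>*\<^sup>* c d" using rtranclp_mono[of "\<lambda>x y. line G x y \<and> x \<in> C \<and> y \<in> C" ?Q] con[OF c(1) d(1)]
    by blast
  moreover have "?Q s c" "?Q d t" using c d by simp_all
  ultimately have "?Q\<^sup>*\<^sup>* s t"
    by (intro rtranclp.rtrancl_into_rtrancl[of ?Q s d t]
        converse_rtranclp_into_rtranclp[of ?Q s c d])
  then obtain n p where p: "p 0 = s" "p n = t" "\<And>i. i < n \<Longrightarrow> ?Q (p i) (p (Suc i))"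
    and dist: "\<And>i j. i < j \<Longrightarrow> j \<le> n \<Longrightarrow> p i \<noteq> p j"
    and short: "\<And>i j. Suc i < j \<Longrightarrow> j \<le> n \<Longrightarrow> \<not> ?Q (p i) (p j)"
    by (rule shortest_path) blast
  have "n \<noteq> 0" using p(1,2) st(3) by (intro notI) simp
  moreover have "n \<noteq> 1" using p(1,2) p(3)[of 0] nst by (intro notI) simp
  ultimately have n: "n \<ge> 2" by simp
  have pD: "p i \<in> ?D" if "i \<le> n" for i
    using that p(2) p(3)[of i] by (cases "i = n") auto
  have pC: "p i \<in> C" if "0 < i" "i < n" for i
    using pD[of i] dist[of 0 i] dist[of i n] p(1,2) that by auto
  have DU: "?D \<subseteq> U" using C(1) st by blast
  let ?vs = "v # map p [0..<Suc n]"
  have nth0: "?vs ! 0 = v" by simp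
  have nth: "?vs ! Suc i = p i" if "i \<le> n" for i
  proof -
    have "map p [0..<Suc n] ! i = p ([0..<Suc n] ! i)" using that by (intro nth_map) simp
    then show ?thesis using that by (simp del: upt_Suc)
  qed
  have len: "length ?vs = n + 2" by simp
  have "inj_on p {0..<Suc n}"
    unfolding inj_on_def using dist
    by (metis atLeastLessThan_iff less_Suc_eq_le linorder_neqE_nat)
  moreover have "v \<notin> ?D" using C(2) st by blast
  then have "p i \<noteq> v" if "i \<le> n" for i using pD[OF that] by metis
  then have "v \<notin> p ` {0..<Suc n}" by (fastforce simp: less_Suc_eq_le)
  ultimately have dvs: "distinct ?vs" by (simp add: distinct_map del: upt_Suc)
  have "p i \<in> U" if "i \<le> n" for i using pD[OF that] DU by (rule subsetD[rotated])
  then have sub: "set ?vs \<subseteq> U" using v by (auto simp del: upt_Suc simp: less_Suc_eq_le)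
  have lines: "line G (?vs ! i) (?vs ! (Suc i mod length ?vs))" if i: "i < length ?vs" for i
  proof -
    consider "i = 0" | j where "i = Suc j" "j < n" | "i = Suc n"
      using i len by (cases i) force+
    then show ?thesis
    proof cases
      case 1
      have "Suc i mod length ?vs = Suc 0" unfolding len using n 1 by simp
      then show ?thesis using 1 nth[of 0] p(1) st by simp
    next
      case 2
      have "Suc i mod length ?vs = Suc (Suc j)" unfolding len using 2 by simp
      then show ?thesis using 2 nth[of j] nth[of "Suc j"] p(3)[of j] by simp
    next
      case 3
      have "Suc i mod length ?vs = 0" unfolding len using 3 by simp
      then show ?thesis using 3 nth[of n] p(2) st line_sym[of G] nth0 by simp
    qed
  qed
  \<comment> \<open>A chord at \<open>v\<close> would end inside the path, hence in
    \<open>C\<close>, which has no neighbours of \<open>v\<close>; any other chord would be a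
    shortcut of the path.\<close>
  have chord: "j = Suc i mod length ?vs \<or> i = Suc j mod length ?vs"
    if ij: "i < j" "j < length ?vs" and a: "adjacent G (?vs ! i) (?vs ! j)" for i j
  proof -
    have "?vs ! i \<in> U" "?vs ! j \<in> U"
      using sub ij by (meson less_trans nth_mem subsetD)+
    with a have l: "line G (?vs ! i) (?vs ! j)" by (intro adj)
    obtain b where b: "j = Suc b" "b \<le> n" using ij len by (cases j) auto
    show ?thesis
    proof (cases i)
      case 0
      then have "line G v (p b)" using l nth[OF b(2)] b(1) by simp
      then have "\<not> (0 < b \<and> b < n)" using pC C(3) by blast
      then have "b = 0 \<or> b = n" using b by auto
      then show ?thesis unfolding len using 0 b by auto
    next
      case (Suc a)
      then have "?Q (p a) (p b)" using l nth[OF b(2)] nth[of a] b ij pD by simp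
      then have "\<not> Suc a < b" using short b(2) by blast
      then show ?thesis unfolding len using Suc b ij by simp
    qed
  qed
  have "\<not> adjacent G (?vs ! i) (?vs ! j)"
    if "i < length ?vs" "j < length ?vs" "i \<noteq> j" "j \<noteq> Suc i mod length ?vs" "i \<noteq> Suc j mod length ?vs"
    for i j
    using chord[of i j] chord[of j i] that adjacent_sym[of G] by (metis linorder_neqE_nat)
  moreover have "(?vs ! i, ?vs ! (Suc i mod length ?vs)) \<in> edges G" if "i < length ?vs" for i
    using lines[OF that] unfolding line_def by (rule conjunct1)
  ultimately have "chordless_undirected_cycle G ?vs"
    unfolding chordless_undirected_cycle_def undirected_cycle_def cycle_def
    using dvs lines sub U n len by auto
  with nc sub show False by blast
qed

text \<open>A form of Dirac's lemma on simplicial vertices of chordal graphs. Fixing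
  \<open>v\<close> and asking for a simplicial vertex not joined to it makes the induction go
  through, since the inductive hypothesis can be applied with a new base vertex.\<close>

lemma simplicial_nonneighbour:
  assumes "finite U" "U \<subseteq> verts G"
    and "\<And>x y. x \<in> U \<Longrightarrow> y \<in> U \<Longrightarrow> adjacent G x y \<Longrightarrow> line G x y"
    and "\<And>vs. chordless_undirected_cycle G vs \<Longrightarrow> \<not> set vs \<subseteq> U"
    and "v \<in> U" "u \<in> U" "u \<noteq> v" "\<not> line G v u"
  shows "\<exists>w\<in>U. w \<noteq> v \<and> \<not> line G v w \<and>
    (\<forall>x\<in>U. \<forall>y\<in>U. line G w x \<longrightarrow> line G w y \<longrightarrow> x \<noteq> y \<longrightarrow> line G x y)"
  using assms
proof (induction U arbitrary: v u rule: finite_psubset_induct)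
  case (psubset U)
  let ?M = "{x \<in> U. x \<noteq> v \<and> \<not> line G v x}"
  let ?Q = "\<lambda>x y. line G x y \<and> x \<in> ?M \<and> y \<in> ?M"
  \<comment> \<open>The component of \<open>u\<close> among the non-neighbours of \<open>v\<close>.
    All neighbours in \<open>U\<close> of its vertices lie in \<open>C\<close> or in the set
    \<open>S\<close> defined below, so a vertex of \<open>C\<close> that is simplicial in their
    union is simplicial in \<open>U\<close>.\<close>
  define C where "C = {c. ?Q\<^sup>*\<^sup>* u c}"
  have uC: "u \<in> C" by (simp add: C_def)
  have CM: "C \<subseteq> ?M"
  proof
    fix c assume "c \<in> C"
    then have "?Q\<^sup>*\<^sup>* u c" by (simp add: C_def)
    then show "c \<in> ?M" using psubset.prems by (induction rule: rtranclp_induct) auto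
  qed
  let ?R = "\<lambda>x y. line G x y \<and> x \<in> C \<and> y \<in> C"
  have uc: "?R\<^sup>*\<^sup>* u c" if "c \<in> C" for c
  proof -
    have "?Q\<^sup>*\<^sup>* u c" using that by (simp add: C_def)
    then show ?thesis
    proof (induction rule: rtranclp_induct)
      case (step y z)
      then have "?R y z" by (auto simp: C_def intro: rtranclp.rtrancl_into_rtrancl)
      with step.IH show ?case by (rule rtranclp.rtrancl_into_rtrancl)
    qed simp
  qed
  have "symp ?R\<^sup>*\<^sup>*" by (intro symp_rtranclp sympI) (auto simp: line_sym)
  then have con: "?R\<^sup>*\<^sup>* c d" if "c \<in> C" "d \<in> C" for c d
    using uc[OF that(1)] uc[OF that(2)] by (meson rtranclp_trans sympD)
  define S where "S = {s \<in> U. s \<noteq> v \<and> line G v s \<and> (\<exists>c\<in>C. line G s c)}"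
  have SS: "line G s t" if "s \<in> S" "t \<in> S" "s \<noteq> t" for s t
  proof -
    have "\<exists>c\<in>C. line G s c" "\<exists>d\<in>C. line G d t"
      using that by (auto simp: S_def line_sym[of G t])
    then obtain c d where "c \<in> C" "line G s c" "d \<in> C" "line G d t" by blast
    then show ?thesis
      using that psubset.prems CM con
      by (intro separator_complete[of G U C v s t c d]) (auto simp: S_def)
  qed
  have closed: "x \<in> C \<union> S" if "x \<in> U" "c \<in> C" "line G c x" for x c
  proof (cases "line G v x")
    case True
    have "x \<noteq> v" using that CM line_sym[of G] by blast
    with True that show ?thesis using line_sym[of G] by (auto simp: S_def)
  next
    case False
    have "x \<noteq> v" using that CM line_sym[of G] by blast
    with False that CM have "?Q c x" by blast
    with that have "x \<in> C" unfolding C_def by (auto intro: rtranclp.rtrancl_into_rtrancl)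
    then show ?thesis by simp
  qed
  have sub: "C \<union> S \<subset> U" using psubset.prems CM by (auto simp: S_def)
  have IH: "\<exists>w\<in>C \<union> S. w \<noteq> z \<and> \<not> line G z w \<and>
      (\<forall>x\<in>C \<union> S. \<forall>y\<in>C \<union> S. line G w x \<longrightarrow> line G w y \<longrightarrow> x \<noteq> y \<longrightarrow> line G x y)"
    if "z \<in> C \<union> S" "y \<in> C \<union> S" "y \<noteq> z" "\<not> line G z y" for z y
  proof (rule psubset.IH[OF sub _ _ _ that])
    show "C \<union> S \<subseteq> verts G" using sub psubset.prems(1) by blast
    show "line G x y" if "x \<in> C \<union> S" "y \<in> C \<union> S" "adjacent G x y" for x y
      using that sub by (intro psubset.prems(2)) auto
    show "\<not> set vs \<subseteq> C \<union> S" if "chordless_undirected_cycle G vs" for vs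
      using psubset.prems(3)[OF that] sub by blast
  qed
  \<comment> \<open>The base vertex is chosen so that the simplicial vertex found falls into
    \<open>C\<close>. If the base lies in the complete set \<open>S\<close>, a non-neighbour of it
    cannot lie in \<open>S\<close>. If every vertex of \<open>S\<close> is joined to everything, a
    base in \<open>C\<close> has no non-neighbour in \<open>S\<close>. Otherwise the union is
    complete and \<open>u\<close> serves.\<close>
  have "\<exists>w\<in>C. \<forall>x\<in>C \<union> S. \<forall>y\<in>C \<union> S. line G w x \<longrightarrow> line G w y \<longrightarrow> x \<noteq> y \<longrightarrow> line G x y"
  proof (cases "\<exists>s\<in>S. \<exists>y\<in>C \<union> S. y \<noteq> s \<and> \<not> line G s y")
    case True
    then obtain s y where "s \<in> S" "y \<in> C \<union> S" "y \<noteq> s" "\<not> line G s y" by blast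
    with IH[of s y] SS show ?thesis by blast
  next
    case False
    show ?thesis
    proof (cases "\<exists>c\<in>C. \<exists>y\<in>C \<union> S. y \<noteq> c \<and> \<not> line G c y")
      case True
      then obtain c y where c: "c \<in> C" "y \<in> C \<union> S" "y \<noteq> c" "\<not> line G c y" by blast
      then obtain w where w: "w \<in> C \<union> S" "w \<noteq> c" "\<not> line G c w"
        "\<forall>x\<in>C \<union> S. \<forall>y\<in>C \<union> S. line G w x \<longrightarrow> line G w y \<longrightarrow> x \<noteq> y \<longrightarrow> line G x y"
        using IH[of c y] by blast
      have "\<not> line G w c" using w(3) by (simp add: line_sym)
      then have "w \<notin> S" using False c(1) w(2) by (metis UnI1)
      with w show ?thesis by blast
    next
      case F: False
      have "line G x y" if "x \<in> C \<union> S" "y \<in> C \<union> S" "x \<noteq> y" for x y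
        using F False that by (metis UnE)
      then show ?thesis using uC by (intro bexI[of _ u] ballI impI) simp_all
    qed
  qed
  then obtain w where w: "w \<in> C"
    "\<forall>x\<in>C \<union> S. \<forall>y\<in>C \<union> S. line G w x \<longrightarrow> line G w y \<longrightarrow> x \<noteq> y \<longrightarrow> line G x y" by blast
  show ?case
    using w closed CM by (intro bexI[of _ w]) blast+
qed

text \<open>A non-neighbour of one end of the line is automatically different from both ends. If
  both ends are joined to everything, a non-neighbour of any third vertex will do, and in a complete
  graph every vertex is simplicial.\<close>

lemma simplicial_off_line:
  assumes U: "finite U" "U \<subseteq> verts G"
    and adj: "\<And>x y. x \<in> U \<Longrightarrow> y \<in> U \<Longrightarrow> adjacent G x y \<Longrightarrow> line G x y"
    and nc: "\<And>vs. chordless_undirected_cycle G vs \<Longrightarrow> \<not> set vs \<subseteq> U"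
    and xy: "x \<in> U" "y \<in> U" "line G x y" and ne: "U \<noteq> {x, y}"
  shows "\<exists>w\<in>U - {x, y}. \<forall>a\<in>U. \<forall>b\<in>U. line G w a \<longrightarrow> line G w b \<longrightarrow> a \<noteq> b \<longrightarrow> line G a b"
proof -
  have *: "\<exists>w\<in>U. w \<noteq> v \<and> \<not> line G v w \<and>
      (\<forall>a\<in>U. \<forall>b\<in>U. line G w a \<longrightarrow> line G w b \<longrightarrow> a \<noteq> b \<longrightarrow> line G a b)"
    if "v \<in> U" "u \<in> U" "u \<noteq> v" "\<not> line G v u" for u v
    using simplicial_nonneighbour[OF U adj nc that] .
  consider u where "u \<in> U" "u \<noteq> x" "\<not> line G x u" | u where "u \<in> U" "u \<noteq> y" "\<not> line G y u"
    | u v where "v \<in> U" "u \<in> U" "u \<noteq> v" "\<not> line G v u" "\<And>u. u \<in> U \<Longrightarrow> u \<noteq> x \<Longrightarrow> line G x u"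
      "\<And>u. u \<in> U \<Longrightarrow> u \<noteq> y \<Longrightarrow> line G y u"
    | "\<And>u v. u \<in> U \<Longrightarrow> v \<in> U \<Longrightarrow> u \<noteq> v \<Longrightarrow> line G u v"
    by metis
  then show ?thesis
  proof cases
    case 1
    then show ?thesis using *[of x u] xy by blast
  next
    case 2
    then show ?thesis using *[of y u] xy line_sym[of G x y] by blast
  next
    case 3
    then obtain w where w: "w \<in> U" "w \<noteq> v" "\<not> line G v w"
      "\<forall>a\<in>U. \<forall>b\<in>U. line G w a \<longrightarrow> line G w b \<longrightarrow> a \<noteq> b \<longrightarrow> line G a b"
      using *[of v u] by blast
    have "w \<noteq> x" "w \<noteq> y" using 3(1) 3(5)[of v] 3(6)[of v] w(2,3) line_sym[of G v] by metis+
    with w show ?thesis by blast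
  next
    case 4
    then show ?thesis using xy ne by blast
  qed
qed

text \<open>A simplicial vertex off the line is placed last and the rest is ordered by induction, so
  the line survives to the two-element base case, where its direction is free. Earlier neighbours of
  a vertex are joined, so orienting along \<open>r\<close> produces no immorality.\<close>

lemma perfect_order:
  assumes "finite U" "U \<subseteq> verts G"
    and "\<And>x y. x \<in> U \<Longrightarrow> y \<in> U \<Longrightarrow> adjacent G x y \<Longrightarrow> line G x y"
    and "\<And>vs. chordless_undirected_cycle G vs \<Longrightarrow> \<not> set vs \<subseteq> U"
    and "x \<in> U" "y \<in> U" "line G x y" "x \<noteq> y"
  shows "\<exists>r :: 'a \<Rightarrow> nat. inj_on r U \<and> r x < r y \<and>
    (\<forall>u\<in>U. \<forall>a\<in>U. \<forall>b\<in>U. line G a u \<longrightarrow> line G b u \<longrightarrow> r a < r u \<longrightarrow> r b < r u \<longrightarrow> a \<noteq> b \<longrightarrow> line G a b)"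
  using assms
proof (induction U rule: finite_psubset_induct)
  case (psubset U)
  show ?case
  proof (cases "U = {x, y}")
    case True
    then show ?thesis using psubset.prems
      by (intro exI[of _ "\<lambda>z. if z = x then 0 else 1"]) (auto simp: inj_on_def)
  next
    case False
    obtain w where w: "w \<in> U" "w \<noteq> x" "w \<noteq> y"
      "\<forall>a\<in>U. \<forall>b\<in>U. line G w a \<longrightarrow> line G w b \<longrightarrow> a \<noteq> b \<longrightarrow> line G a b"
      using simplicial_off_line[OF psubset.hyps psubset.prems(1-6) False] by blast
    have sub: "U - {w} \<subset> U" using w(1) by blast
    obtain r :: "'a \<Rightarrow> nat" where r: "inj_on r (U - {w})" "r x < r y"
      "\<forall>u\<in>U - {w}. \<forall>a\<in>U - {w}. \<forall>b\<in>U - {w}. line G a u \<longrightarrow> line G b u \<longrightarrow>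
         r a < r u \<longrightarrow> r b < r u \<longrightarrow> a \<noteq> b \<longrightarrow> line G a b"
      using psubset.IH[OF sub] psubset.prems w by blast
    define r' where "r' = r(w := Suc (Max (r ` U)))"
    have lt: "r' a < r' w" if "a \<in> U" "a \<noteq> w" for a
      using that psubset.hyps by (simp add: r'_def less_Suc_eq_le)
    have eq: "r' a = r a" if "a \<noteq> w" for a using that by (simp add: r'_def)
    have "inj_on r' U"
    proof (rule inj_onI)
      fix a b assume *: "a \<in> U" "b \<in> U" "r' a = r' b"
      show "a = b"
      proof (cases "a = w \<or> b = w")
        case True
        then show ?thesis using * lt[of a] lt[of b] by (metis less_irrefl)
      next
        case False
        then show ?thesis using * eq[of a] eq[of b] inj_onD[OF r(1), of a b] by simp
      qed
    qed
    moreover have "r' x < r' y" using r(2) eq w by simp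
    moreover have "line G a b"
      if *: "u \<in> U" "a \<in> U" "b \<in> U" "line G a u" "line G b u" "r' a < r' u" "r' b < r' u" "a \<noteq> b"
      for u a b
    proof (cases "u = w")
      case True
      then show ?thesis using w(4) * line_sym[of G] by blast
    next
      case False
      then have "a \<noteq> w" "b \<noteq> w" using * lt[of u] by auto
      with False show ?thesis
        using * r(3)[rule_format, of u a b] eq[of u] eq[of a] eq[of b] by simp
    qed
    ultimately show ?thesis by blast
  qed
qed

section \<open>Modifying a chain graph within its equivalence class\<close>

text \<open>Orienting the whole component along a perfect ordering creates no triplex, because two
  earlier neighbours of a vertex are adjacent. It destroys none either: a weak component carries no
  flags, so the triplexes at its vertices are immoralities whose arrows come from outside.\<close>

lemma (in ranked) orient_weak_line:
  assumes xy: "line G x y" and weak: "\<not> strong_vertex G x"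
  shows "\<exists>H. chain_graph H \<and> amp_markov_equivalent G H \<and> arrow H x y"
proof -
  define U where "U = line_component G x"
  have x: "x \<in> verts G" "x \<noteq> y" using xy graph_verts[OF graph] by (auto simp: line_def)
  have U: "U \<subseteq> verts G" unfolding U_def by (rule line_component_subset[OF x(1)])
  have fin: "finite U" using U graph finite_subset by (auto simp: graph_def)
  have fU: "f a = f x" if "a \<in> U" for a using that line_component_rank by (simp add: U_def)
  have adjU: "line G a b" if "a \<in> U" "b \<in> U" "adjacent G a b" for a b
    using that fU adjacent_rank_eq by simp
  have closed: "b \<in> U" if "a \<in> U" "line G a b" for a b
    using that line_component_line by (simp add: U_def)
  have toU: "(line G)\<^sup>*\<^sup>* a x" if "a \<in> U" for a
    using that lines_sym by (simp add: U_def line_component_def)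
  have "\<not> set vs \<subseteq> U" if c: "chordless_undirected_cycle G vs" for vs
  proof
    assume "set vs \<subseteq> U"
    then have "\<exists>v. v \<in> set vs \<and> (line G)\<^sup>*\<^sup>* v x"
      using chordless_not_adjacent(1)[OF c] toU by blast
    with c weak show False by (auto simp: strong_vertex_def)
  qed
  moreover have "x \<in> U" by (simp add: U_def line_component_self)
  moreover from this have "y \<in> U" using closed xy by blast
  ultimately obtain r :: "'a \<Rightarrow> nat" where r: "inj_on r U" "r x < r y"
    and perf: "\<And>u a b. u \<in> U \<Longrightarrow> a \<in> U \<Longrightarrow> b \<in> U \<Longrightarrow> line G a u \<Longrightarrow> line G b u \<Longrightarrow> r a < r u
       \<Longrightarrow> r b < r u \<Longrightarrow> a \<noteq> b \<Longrightarrow> line G a b"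
    using perfect_order[OF fin U adjU _ _ _ xy x(2)] by blast
  define H where "H = \<lparr>verts = verts G,
    edges = {(a, b) \<in> edges G. a \<in> U \<and> b \<in> U \<longrightarrow> r a < r b}\<rparr>"
  have E: "(a, b) \<in> edges H \<longleftrightarrow> (a, b) \<in> edges G \<and> (a \<in> U \<and> b \<in> U \<longrightarrow> r a < r b)" for a b
    by (simp add: H_def)
  have V: "verts H = verts G" by (simp add: H_def)
  have adj: "adjacent H a b \<longleftrightarrow> adjacent G a b" for a b
  proof
    assume a: "adjacent G a b"
    show "adjacent H a b"
    proof (cases "a \<in> U \<and> b \<in> U")
      case True
      with a have "line G a b" "a \<noteq> b" using adjU graph_adjacent[OF graph] by blast+
      moreover from this have "r a < r b \<or> r b < r a"
        using True inj_onD[OF r(1), of a b] by linarith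
      ultimately show ?thesis using True by (auto simp: adjacent_def E line_def)
    qed (use a in \<open>auto simp: adjacent_def E\<close>)
  qed (auto simp: adjacent_def E)
  \<comment> \<open>\<open>N\<close> exceeds every value of \<open>g\<close>, so
    \<open>f v * N + g v\<close> encodes the lexicographic order of old rank and position in the
    perfect ordering.\<close>
  define N where "N = Suc (Max (r ` U))"
  define g where "g v = (if v \<in> U then r v else 0)" for v
  have gN: "g v < N" for v using fin by (simp add: g_def N_def less_Suc_eq_le)
  have lex: "f a * N + g a < f b * N + g b" if "f a < f b" for a b
  proof -
    have "f a * N + g a < Suc (f a) * N" using gN by simp
    also have "\<dots> \<le> f b * N" using that by (intro mult_le_mono1) simp
    finally show ?thesis by simp
  qed
  have inU: "a \<in> U \<longleftrightarrow> b \<in> U" if "line G a b" for a b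
    using closed that line_sym[of G a b] by blast
  have "ranked H (\<lambda>v. f v * N + g v)"
  proof
    show "graph H" using graph by (auto simp: graph_def H_def irrefl_def)
    show "f a * N + g a \<le> f b * N + g b" if ab: "(a, b) \<in> edges H" for a b
    proof (cases "f a < f b")
      case False
      then have eq: "f a = f b" using rank_le[of a b] ab E by simp
      then have "line G a b" using ab E by (intro adjacent_rank_eq) (auto simp: adjacent_def)
      then have "g a \<le> g b" using ab inU[of a b] by (auto simp: E g_def)
      with eq show ?thesis by simp
    qed (use lex[of a b] in simp)
    show "f a * N + g a < f b * N + g b" if ab: "arrow H a b" for a b
    proof (cases "f a < f b")
      case False
      then have eq: "f a = f b" using rank_le[of a b] ab by (simp add: E arrow_def)
      then have l: "line G a b" using ab by (intro adjacent_rank_eq) (auto simp: adjacent_def arrow_def E)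
      then have "a \<in> U \<and> b \<in> U" "r a < r b" using ab by (auto simp: E arrow_def line_def)
      with eq show ?thesis by (simp add: g_def)
    qed (rule lex)
  qed
  then have cH: "chain_graph H" by (rule ranked_imp_chain_graph)
  have nonadj: "nonadjacent H = nonadjacent G"
    using adj V by (simp add: nonadjacent_def fun_eq_iff)
  have "triplex H u v w \<longleftrightarrow> triplex G u v w" for u v w
  proof (cases "v \<in> U")
    case False
    then show ?thesis by (simp add: triplex_def nonadj E line_def)
  next
    case v: True
    show ?thesis
    proof
      assume t: "triplex H u v w"
      then have uw: "nonadjacent G u w" "(u, v) \<in> edges G" "(w, v) \<in> edges G"
        by (auto simp: triplex_def nonadj E)
      show "triplex G u v w"
      proof (rule ccontr)
        assume "\<not> triplex G u v w"
        then have l: "line G u v" "line G v w" using uw by (auto simp: triplex_def)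
        then have "u \<in> U" "w \<in> U" using v inU by blast+
        moreover from this have "r u < r v" "r w < r v" using t v by (auto simp: triplex_def E)
        ultimately have "line G u w"
          using perf[of v u w] v l line_sym[of G v w] uw(1) by (auto simp: nonadjacent_def)
        then have "adjacent G u w" by (rule line_imp_adjacent)
        with uw(1) show False by (simp add: nonadjacent_def)
      qed
    next
      assume t: "triplex G u v w"
      have nf: "\<not> flag G p v q" for p q using weak toU[OF v] unfolding strong_vertex_def by blast
      have "arrow G u v" "arrow G w v"
        using nf[of u w] nf[of w u] t nonadjacent_sym[of G u w]
        by (auto simp: flag_def triplex_def arrow_def line_def)
      moreover from this have "u \<notin> U" "w \<notin> U"
        using rank_less[of u v] rank_less[of w v] fU fU[OF v] by fastforce+
      ultimately show "triplex H u v w"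
        using t by (auto simp: triplex_def nonadj E line_def arrow_def)
    qed
  qed
  then have "amp_markov_equivalent G H"
    using adj V by (auto simp: amp_markov_equivalent_iff fun_eq_iff)
  moreover have "arrow H x y"
    using xy r(2) \<open>x \<in> U\<close> \<open>y \<in> U\<close> by (auto simp: arrow_def E line_def)
  ultimately show ?thesis using cH by blast
qed

text \<open>
  If \<open>\<kappa>\<close> and \<open>\<alpha>\<close> witness a failure of property S', the lines between them can be turned into
  arrows from \<open>\<alpha>\<close> to \<open>\<kappa>\<close>.
\<close>

lemma (in ranked) split_component:
  assumes x: "x \<in> verts G" and S: "\<not> property_S' G (line_component G x)"
  shows "\<exists>H. chain_graph H \<and> amp_markov_equivalent G H \<and> (\<forall>a b. line H a b \<longrightarrow> line G a b) \<and>
    (\<forall>a b. arrow H a b \<longrightarrow> arrow G a b \<or> b \<in> line_component G x) \<and>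
    (\<exists>a\<in>line_component G x. \<exists>b. line G a b \<and> \<not> line H a b)"
proof -
  define X where "X = line_component G x"
  let ?I = "induced G X" and ?J = "induced G (parent_closure G X)"
  have XV: "X \<subseteq> verts G" unfolding X_def by (rule line_component_subset[OF x])
  have fX: "f v = f x" if "v \<in> X" for v using that line_component_rank by (simp add: X_def)
  have closed: "b \<in> X" if "a \<in> X" "line G a b" for a b
    using that line_component_line by (simp add: X_def)
  obtain \<kappa> \<alpha> where k: "\<kappa> \<noteq> {}" "\<kappa> \<subset> X" and a: "\<alpha> = cnb ?I \<kappa>" "\<alpha> \<noteq> {}" "complete_in G \<alpha>"
    and fail: "ncnb ?I \<kappa> = {}" "pa ?J \<alpha> \<subseteq> cpa ?J \<kappa>"
    using S unfolding property_S'_def X_def[symmetric] by blast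
  have aX: "\<alpha> \<subseteq> X - \<kappa>" using a(1) by (auto simp: cnb_def verts_induced)
  have ak: "line G v w" if "v \<in> \<alpha>" "w \<in> \<kappa>" for v w
    using that a(1) induced_edgesD(1)[of G X v w] by (auto simp: cnb_def)
  \<comment> \<open>There are no noncovering neighbours, so every neighbour of
    \<open>\<kappa>\<close> outside it belongs to \<open>\<alpha>\<close>.\<close>
  have nbk: "v \<in> \<alpha>" if "w \<in> \<kappa>" "v \<notin> \<kappa>" "line G v w" for v w
  proof -
    have "v \<in> X" "w \<in> X" using that k closed[of w v] line_sym[of G v w] by auto
    then have "line ?I v w" using that(3) by (simp add: induced_simps)
    then have "v \<in> nb ?I \<kappa>"
      using that(1,2) \<open>v \<in> X\<close> XV by (auto simp: nb_def verts_induced)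
    with fail(1) a(1) show ?thesis by (auto simp: ncnb_def)
  qed
  have pak: "arrow G p w" if "arrow G p v" "v \<in> \<alpha>" "w \<in> \<kappa>" for p v w
  proof -
    have v: "v \<in> X" "w \<in> X" using that aX k by auto
    have p: "p \<notin> X" using rank_less[OF that(1)] fX[of p] fX[OF v(1)] by auto
    have "p \<in> verts G" using that(1) graph_verts[OF graph] by (auto simp: arrow_def)
    then have pc: "p \<in> parent_closure G X" using that v p by (auto simp: parent_closure_def pa_def)
    have vc: "v \<in> parent_closure G X" "w \<in> parent_closure G X" using v by (auto simp: parent_closure_def)
    have "arrow ?J p v" using that(1) pc vc(1) by (simp add: induced_simps)
    then have "p \<in> pa ?J \<alpha>"
      using pc p aX that(2) \<open>p \<in> verts G\<close> by (auto simp: pa_def verts_induced)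
    then have "p \<in> cpa ?J \<kappa>" using fail(2) by blast
    then show ?thesis using that(3) induced_edgesD(2)[of G _ p w] by (auto simp: cpa_def)
  qed
  define H where "H = \<lparr>verts = verts G, edges = edges G - \<kappa> \<times> \<alpha>\<rparr>"
  have E: "(u, v) \<in> edges H \<longleftrightarrow> (u, v) \<in> edges G \<and> \<not> (u \<in> \<kappa> \<and> v \<in> \<alpha>)" for u v
    by (simp add: H_def)
  have V: "verts H = verts G" by (simp add: H_def)
  have disj: "v \<notin> \<kappa>" if "v \<in> \<alpha>" for v using that aX by blast
  have adj: "adjacent H u v \<longleftrightarrow> adjacent G u v" for u v
    using ak[of u v] ak[of v u] disj[of u] disj[of v] by (auto simp: adjacent_def E line_def)
  \<comment> \<open>Doubling the old rank leaves room to lift \<open>\<kappa>\<close> above the rest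
    of its component and still below the next level.\<close>
  define g where "g v = 2 * f v + (if v \<in> \<kappa> then 1 else 0)" for v
  have lt: "g u < g v" if "f u < f v" for u v using that by (auto simp: g_def)
  have "ranked H g"
  proof
    show "graph H" using graph by (auto simp: graph_def H_def irrefl_def)
    show "g u \<le> g v" if uv: "(u, v) \<in> edges H" for u v
    proof (cases "f u < f v")
      case False
      then have eq: "f u = f v" using rank_le[of u v] uv E by simp
      then have l: "line G u v" using uv E by (intro adjacent_rank_eq) (auto simp: adjacent_def)
      have "v \<in> \<kappa>" if "u \<in> \<kappa>" using nbk[OF that, of v] l line_sym[of G u v] uv that by (auto simp: E)
      with eq show ?thesis by (simp add: g_def)
    qed (use lt[of u v] in simp)
    show "g u < g v" if uv: "arrow H u v" for u v
    proof (cases "f u < f v")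
      case False
      then have eq: "f u = f v" using rank_le[of u v] uv by (simp add: E arrow_def)
      then have l: "line G u v" using uv by (intro adjacent_rank_eq) (auto simp: adjacent_def arrow_def E)
      then have "v \<in> \<kappa> \<and> u \<in> \<alpha>" using uv by (auto simp: E arrow_def line_def)
      with eq disj show ?thesis by (simp add: g_def)
    qed (rule lt)
  qed
  then have cH: "chain_graph H" by (rule ranked_imp_chain_graph)
  have nonadj: "nonadjacent H = nonadjacent G"
    using adj V by (simp add: nonadjacent_def fun_eq_iff)
  \<comment> \<open>A deleted pair runs from \<open>\<kappa>\<close> to \<open>\<alpha>\<close>. In
    a triplex the other edge into its head would be an arrow, and the source of that arrow would be
    a parent of all of \<open>\<kappa>\<close>, hence adjacent to \<open>u\<close>.\<close>
  have kept: "(u, v) \<in> edges H" if t: "triplex G u v w" for u v w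
  proof (rule ccontr)
    assume "(u, v) \<notin> edges H"
    then have uv: "u \<in> \<kappa>" "v \<in> \<alpha>" using t by (auto simp: triplex_def E)
    then have "line G u v" using ak[of v u] line_sym[of G u v] by simp
    then have "arrow G w v" using t by (auto simp: triplex_def arrow_def line_def)
    from pak[OF this uv(2,1)] t show False
      by (auto simp: triplex_def nonadjacent_def adjacent_def arrow_def)
  qed
  \<comment> \<open>A new triplex would have its middle in \<open>\<kappa>\<close> and one end in
    \<open>\<alpha>\<close>. The other end is in \<open>\<kappa>\<close> or in
    \<open>\<alpha>\<close>, and both are adjacent to the first end: \<open>\<alpha>\<close> covers
    \<open>\<kappa>\<close> and is complete.\<close>
  have new: "\<not> (line G u v \<and> line G v w)"
    if t: "triplex H u v w" and r: "(v, u) \<notin> edges H" for u v w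
  proof
    assume l: "line G u v \<and> line G v w"
    then have uv: "u \<in> \<alpha>" "v \<in> \<kappa>" using r by (auto simp: E line_def)
    have "adjacent G u w"
    proof (cases "w \<in> \<kappa>")
      case True
      then show ?thesis using ak uv line_imp_adjacent by metis
    next
      case False
      then have "w \<in> \<alpha>" using nbk[OF uv(2)] l line_sym[of G v w] by blast
      then show ?thesis using a(3) uv t by (auto simp: complete_in_def triplex_def nonadjacent_def)
    qed
    with t show False by (auto simp: triplex_def nonadj nonadjacent_def)
  qed
  have "triplex H u v w \<longleftrightarrow> triplex G u v w" for u v w
  proof
    assume t: "triplex H u v w"
    then have "(v, u) \<notin> edges H \<or> (v, w) \<notin> edges H" by (auto simp: triplex_def line_def)
    then have "\<not> (line G u v \<and> line G v w)"
      using new[of u v w] new[of w v u] t triplex_sym[of H u v w] line_sym[of G] by metis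
    with t show "triplex G u v w" by (auto simp: triplex_def nonadj E)
  next
    assume t: "triplex G u v w"
    then have "(u, v) \<in> edges H" "(w, v) \<in> edges H" using kept triplex_sym[of G u v w] by blast+
    with t show "triplex H u v w" by (auto simp: triplex_def nonadj E line_def)
  qed
  then have "amp_markov_equivalent G H"
    using adj V by (auto simp: amp_markov_equivalent_iff fun_eq_iff)
  moreover have "\<forall>u v. line H u v \<longrightarrow> line G u v" by (auto simp: line_def E)
  moreover have "\<forall>u v. arrow H u v \<longrightarrow> arrow G u v \<or> v \<in> X"
    using k(2) by (auto simp: arrow_def E)
  moreover have "\<exists>u\<in>X. \<exists>v. line G u v \<and> \<not> line H u v"
  proof -
    obtain u v where "u \<in> \<alpha>" "v \<in> \<kappa>" using k(1) a(2) by blast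
    then show ?thesis using ak aX by (intro bexI[of _ u] exI[of _ v]) (auto simp: line_def E)
  qed
  ultimately show ?thesis using cH unfolding X_def by blast
qed

text \<open>
  An arrow \<open>a \<rightarrow> b\<close> that is not well protected joins two weak components \<open>A\<close> and \<open>B\<close>, and turning
  all arrows from \<open>A\<close> to \<open>B\<close> into lines merges them.
\<close>

lemma (in ranked) merge_components:
  assumes ab: "arrow G a b" and np: "\<not> well_protected G a b"
  shows "\<exists>H. chain_graph H \<and> amp_markov_equivalent G H \<and>
    {(u, v). arrow H u v} \<subset> {(u, v). arrow G u v} \<and>
    {(u, v). strong_line H u v} \<subseteq> {(u, v). strong_line G u v}"
proof -
  define A where "A = line_component G a"
  define B where "B = line_component G b"
  have abV: "a \<in> verts G" "b \<in> verts G" using ab graph_verts[OF graph] by (auto simp: arrow_def)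
  have fab: "f a < f b" by (rule rank_less[OF ab])
  have fA: "f v = f a" if "v \<in> A" for v using that line_component_rank by (simp add: A_def)
  have fB: "f v = f b" if "v \<in> B" for v using that line_component_rank by (simp add: B_def)
  have disj: "v \<notin> B" if "v \<in> A" for v using that fA[of v] fB[of v] fab by auto
  have aA: "a \<in> A" and bB: "b \<in> B" by (auto simp: A_def B_def line_component_self)
  have clA: "v \<in> A" if "u \<in> A" "line G u v" for u v using that line_component_line by (simp add: A_def)
  have clB: "v \<in> B" if "u \<in> B" "line G u v" for u v using that line_component_line by (simp add: B_def)
  have AV: "A \<subseteq> verts G" "B \<subseteq> verts G"
    unfolding A_def B_def using abV by (simp_all add: line_component_subset)
  have np1: "arrow G c a \<Longrightarrow> \<not> nonadjacent G c b"
    and np2: "arrow G c b \<Longrightarrow> \<not> nonadjacent G a c"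
    and np3: "arrow G a c \<Longrightarrow> \<not> arrow G c b"
    and np4: "arrow G c b \<Longrightarrow> arrow G d b \<Longrightarrow> line G a c \<Longrightarrow> line G a d \<Longrightarrow> \<not> nonadjacent G c d"
    and np5: "arrow G c b \<Longrightarrow> \<not> strong_line G a c"
    and np6: "strong_line G c a \<Longrightarrow> \<not> nonadjacent G c b"
    and np7: "strong_line G b c \<Longrightarrow> \<not> nonadjacent G a c"
    and np8: "arrow G a c \<Longrightarrow> \<not> strong_line G b c" for c d
    using np ab unfolding well_protected_def by blast+
  have ex: "\<exists>c. line G v c" if "strong_vertex G v" for v
  proof -
    have "\<exists>u z. line G u z \<and> (line G)\<^sup>*\<^sup>* u v"
      using that unfolding strong_vertex_def
    proof (elim disjE exE conjE)
      fix vs u assume c: "chordless_undirected_cycle G vs" "u \<in> set vs" "(line G)\<^sup>*\<^sup>* u v"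
      then obtain i where "i < length vs" "u = vs ! i" by (auto simp: in_set_conv_nth)
      then show ?thesis using c by (auto simp: chordless_undirected_cycle_def undirected_cycle_def)
    next
      fix p u z assume "flag G p u z" "(line G)\<^sup>*\<^sup>* u v"
      then show ?thesis by (auto simp: flag_def)
    qed
    then obtain u z where uz: "line G u z" "(line G)\<^sup>*\<^sup>* u v" by blast
    from uz(2,1) show ?thesis
      by (cases rule: rtranclp.cases) (auto simp: line_sym)
  qed
  \<comment> \<open>If \<open>a\<close> were strong, any line at it would give configuration (vi) or
    (v), according to whether its other end is adjacent to \<open>b\<close>. In the same way (vii)
    and (viii) make \<open>b\<close> weak.\<close>
  have wa: "\<not> strong_vertex G a"
  proof
    assume s: "strong_vertex G a"
    then obtain c where c: "line G a c" using ex by blast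
    with s have s: "strong_line G a c" "strong_line G c a"
      using strong_vertex_lines[OF s, of c] line_sym[of G a c] by (auto simp: strong_line_iff)
    have fc: "f c < f b" using rank_line[OF c] fab by simp
    moreover have "c \<in> verts G" using c graph_verts[OF graph] by (auto simp: line_def)
    ultimately have "adjacent G c b" using np6[OF s(2)] abV by (auto simp: nonadjacent_def)
    then have "arrow G c b" using fc by (rule adjacent_rank_less)
    with np5 s(1) show False by blast
  qed
  have wb: "\<not> strong_vertex G b"
  proof
    assume s: "strong_vertex G b"
    then obtain c where c: "line G b c" using ex by blast
    with s have s: "strong_line G b c" by (simp add: strong_line_iff)
    have fc: "f a < f c" using rank_line[OF c] fab by simp
    moreover have "c \<in> verts G" using c graph_verts[OF graph] by (auto simp: line_def)
    ultimately have "adjacent G a c" using np7[OF s] abV by (auto simp: nonadjacent_def)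
    then have "arrow G a c" using fc by (rule adjacent_rank_less)
    with np8 s show False by blast
  qed
  have paA: "arrow G p v" if "arrow G p u" "u \<in> A" "v \<in> A" for p u v
    using weak_common_parents[OF wa _ that(1)] that(2,3)
    unfolding A_def line_component_def by (auto dest: lines_sym intro: rtranclp_trans)
  have paB: "arrow G p v" if "arrow G p u" "u \<in> B" "v \<in> B" for p u v
    using weak_common_parents[OF wb _ that(1)] that(2,3)
    unfolding B_def line_component_def by (auto dest: lines_sym intro: rtranclp_trans)
  have adja: "adjacent G a c" if "arrow G c b" "c \<noteq> a" for c
    using np2[OF that(1)] that abV graph_verts[OF graph, of c b]
    by (auto simp: nonadjacent_def arrow_def)
  \<comment> \<open>Parents of \<open>B\<close> inside \<open>A\<close> are parents of
    \<open>b\<close>. Excluding (ii) joins each of them to \<open>a\<close>, and then excluding (iv)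
    joins any two of them.\<close>
  have compl: "adjacent G c d" if "c \<in> A" "d \<in> A" "arrow G c u" "arrow G d v" "u \<in> B" "v \<in> B" "c \<noteq> d"
    for c d u v
  proof -
    have cb: "arrow G c b" "arrow G d b" using that paB bB by blast+
    have l: "line G a w" if "w \<in> A" "arrow G w b" "w \<noteq> a" for w
      using adja that fA adjacent_rank_eq by simp
    show ?thesis
    proof (cases "c = a \<or> d = a")
      case True
      then show ?thesis using adja[OF cb(1)] adja[OF cb(2)] that(7) adjacent_sym[of G] by metis
    next
      case False
      then show ?thesis using np4[OF cb l l] cb that AV by (auto simp: nonadjacent_def)
    qed
  qed
  \<comment> \<open>Excluding (ii) makes \<open>p\<close> adjacent to \<open>a\<close>, excluding
    (iii) rules out an arrow from \<open>a\<close> to \<open>p\<close>, and a line would put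
    \<open>p\<close> into \<open>A\<close>. Together with \<open>AB\<close>, which excludes (i),
    this gives the merged component common parents.\<close>
  have BA: "arrow G p v" if "arrow G p u" "u \<in> B" "p \<notin> A" "v \<in> A" for p u v
  proof -
    have pb: "arrow G p b" using that paB bB by blast
    have "p \<noteq> a" using that aA by blast
    with pb have adj: "adjacent G a p" by (rule adja)
    have "\<not> arrow G a p" using np3 pb by blast
    moreover have "\<not> line G a p" using that clA aA by blast
    ultimately have "arrow G p a" using adj by (auto simp: arrow_def line_def adjacent_def)
    with paA aA that show ?thesis by blast
  qed
  have AB: "arrow G p v" if "arrow G p u" "u \<in> A" "v \<in> B" for p u v
  proof -
    have pa: "arrow G p a" using that paA aA by blast
    have "f p < f b" using rank_less[OF pa] fab by simp
    moreover have "p \<in> verts G" using pa graph_verts[OF graph] by (auto simp: arrow_def)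
    ultimately have "adjacent G p b" using np1[OF pa] abV by (auto simp: nonadjacent_def)
    then have "arrow G p b" using \<open>f p < f b\<close> by (rule adjacent_rank_less)
    with paB bB that show ?thesis by blast
  qed
  define H where "H = \<lparr>verts = verts G, edges = edges G \<union> {(v, u). u \<in> A \<and> v \<in> B \<and> (u, v) \<in> edges G}\<rparr>"
  have E: "(u, v) \<in> edges H \<longleftrightarrow> (u, v) \<in> edges G \<or> (v \<in> A \<and> u \<in> B \<and> (v, u) \<in> edges G)" for u v
    by (auto simp: H_def)
  have V: "verts H = verts G" by (simp add: H_def)
  have adj: "adjacent H u v \<longleftrightarrow> adjacent G u v" for u v
    by (auto simp: adjacent_def E)
  have arrAB: "arrow G u v" if "u \<in> A" "v \<in> B" "adjacent G u v" for u v
    using adjacent_rank_less[OF that(3)] fA[OF that(1)] fB[OF that(2)] fab by simp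
  define M where "M = A \<union> B"
  have lineH: "line H u v \<longleftrightarrow> line G u v \<or> (adjacent G u v \<and> (u \<in> A \<and> v \<in> B \<or> u \<in> B \<and> v \<in> A))" for u v
    using arrAB[of u v] arrAB[of v u] adjacent_sym[of G u v]
    by (auto simp: line_def E arrow_def adjacent_def)
  have arrowH: "arrow H u v \<longleftrightarrow> arrow G u v \<and> \<not> (u \<in> A \<and> v \<in> B)" for u v
    using arrAB[of v u] by (auto simp: arrow_def E adjacent_def)
  let ?e = "\<lambda>u v. (u, v) \<in> edges G"
  have frank: "f u \<le> f v" if "?e\<^sup>*\<^sup>* u v" for u v
    using that by (induction rule: rtranclp_induct) (auto dest: rank_le)
  define D where "D = {v. v \<notin> M \<and> (\<exists>m\<in>M. ?e\<^sup>*\<^sup>* m v)}"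
  have paM: "arrow G p v" if "arrow G p u" "u \<in> M" "p \<notin> M" "v \<in> M" for p u v
  proof -
    have "arrow G p a"
      using that BA[of p u a] paA[of p u a] aA by (auto simp: M_def)
    then show ?thesis using that paA[of p a v] AB[of p a v] aA by (auto simp: M_def)
  qed
  \<comment> \<open>An edge back into \<open>M\<close> would make \<open>d\<close> a parent of all
    of \<open>M\<close>, including the vertex of which it is a descendant.\<close>
  have DM: "(d, v) \<notin> edges G" if d: "d \<in> D" and v: "v \<in> M" for d v
  proof
    assume dv: "(d, v) \<in> edges G"
    obtain m where m: "m \<in> M" "?e\<^sup>*\<^sup>* m d" "d \<notin> M" using d by (auto simp: D_def)
    have "\<not> line G d v" using v m(3) clA[of v d] clB[of v d] line_sym[of G d v] by (auto simp: M_def)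
    then have "arrow G d v" using dv by (auto simp: arrow_def line_def)
    then have "arrow G d m" using paM v m by blast
    then show False using rank_less frank[OF m(2)] by fastforce
  qed
  have fin: "finite (verts G)" using graph by (simp add: graph_def)
  define N where "N = Suc (Max (f ` verts G))"
  have fN: "f v < N" if "v \<in> verts G" for v
    using that fin by (simp add: N_def less_Suc_eq_le)
  \<comment> \<open>Other vertices may have ranks between those of \<open>A\<close> and
    \<open>B\<close>, so the two levels cannot just be identified. \<open>M\<close> is lifted above
    all old ranks, its descendants are shifted above \<open>M\<close>, and all other vertices keep
    their rank.\<close>
  define g where "g v = (if v \<in> M then N else if v \<in> D then N + 1 + f v else f v)" for v
  have stepD: "v \<in> M \<union> D" if "u \<in> M \<union> D" "(u, v) \<in> edges G" for u v
    using that by (auto simp: D_def intro: rtranclp.rtrancl_into_rtrancl)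
  have "ranked H g"
  proof
    show "graph H" using graph AV by (auto simp: graph_def H_def irrefl_def)
    have *: "g u \<le> g v" if uv: "(u, v) \<in> edges G" for u v
      using uv stepD[of u v] DM[of u v] rank_le[of u v] fN[of u] graph_verts[OF graph uv]
      by (auto simp: g_def)
    show "g u \<le> g v" if uv: "(u, v) \<in> edges H" for u v
    proof (cases "(u, v) \<in> edges G")
      case False
      then show ?thesis using uv by (simp add: E g_def M_def)
    qed (rule *)
    show "g u < g v" if uv: "arrow H u v" for u v
    proof -
      have G: "arrow G u v" using uv by (simp add: arrowH)
      then have G': "(u, v) \<in> edges G" by (simp add: arrow_def)
      have "\<not> (u \<in> M \<and> v \<in> M)"
        using uv rank_less[OF G] fA[of u] fA[of v] fB[of u] fB[of v] fab
        by (auto simp: M_def arrowH)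
      then show ?thesis
        using stepD[of u v] G' DM[of u v] rank_less[OF G] fN[of u] graph_verts[OF graph G']
        by (auto simp: g_def)
    qed
  qed
  then interpret H: ranked H g .
  have cH: "chain_graph H" by (rule ranked_imp_chain_graph) fact
  have nonadj: "nonadjacent H = nonadjacent G"
    using adj V by (simp add: nonadjacent_def fun_eq_iff)
  \<comment> \<open>If both edges became lines, then \<open>u\<close> is in \<open>A\<close> and
    \<open>v\<close> in \<open>B\<close>. Either \<open>w\<close> is in \<open>B\<close> and shares
    the parent \<open>u\<close>, or \<open>w\<close> is another parent of \<open>B\<close> in
    \<open>A\<close>, adjacent to \<open>u\<close> by \<open>compl\<close>.\<close>
  have kept: "\<not> (line H u v \<and> line H v w)" if t: "triplex G u v w" and r: "(v, u) \<notin> edges G" for u v w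
  proof
    assume l: "line H u v \<and> line H v w"
    have t': "nonadjacent G u w" "(u, v) \<in> edges G" "(w, v) \<in> edges G"
      using t by (auto simp: triplex_def)
    have uv: "u \<in> A" "v \<in> B" using l r by (auto simp: line_def E)
    have u: "arrow G u v" using t' r by (simp add: arrow_def)
    have "adjacent G u w"
    proof (cases "line G v w")
      case True
      then have "w \<in> B" using clB uv by blast
      then show ?thesis using paB u uv arrow_imp_adjacent by metis
    next
      case False
      then have "w \<in> A" using l lineH[of v w] uv disj by blast
      moreover have "arrow G w v" using arrAB[of w v] \<open>w \<in> A\<close> uv t' by (auto simp: adjacent_def)
      ultimately show ?thesis using compl[of u w v v] uv u t'(1) by (auto simp: nonadjacent_def)
    qed
    with t'(1) show False by (simp add: nonadjacent_def)
  qed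
  \<comment> \<open>A triplex that uses an added pair from \<open>B\<close> to \<open>A\<close>
    needs an arrow into \<open>A\<close> on its other side, and by \<open>AB\<close> the source of
    this arrow is a parent of \<open>u\<close> too.\<close>
  have new: "(u, v) \<in> edges G" if t: "triplex H u v w" for u v w
  proof (rule ccontr)
    assume n: "(u, v) \<notin> edges G"
    have t': "nonadjacent G u w" "(u, v) \<in> edges H" "(w, v) \<in> edges H"
      using t by (auto simp: triplex_def nonadj)
    then have uv: "v \<in> A" "u \<in> B" "(v, u) \<in> edges G" using n by (auto simp: E)
    then have "line H u v" by (auto simp: lineH adjacent_def)
    then have "arrow H w v" using t t' by (auto simp: triplex_def line_def arrow_def)
    then have "arrow G w v" by (simp add: arrowH)
    then have "arrow G w u" using AB uv by blast
    with t'(1) show False by (auto simp: nonadjacent_def adjacent_def arrow_def)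
  qed
  have "triplex H u v w \<longleftrightarrow> triplex G u v w" for u v w
  proof
    assume t: "triplex H u v w"
    then have "(u, v) \<in> edges G" "(w, v) \<in> edges G" using new triplex_sym[of H u v w] by blast+
    with t show "triplex G u v w" by (auto simp: triplex_def nonadj lineH)
  next
    assume t: "triplex G u v w"
    then have "(v, u) \<notin> edges G \<or> (v, w) \<notin> edges G" by (auto simp: triplex_def line_def)
    then have "\<not> (line H u v \<and> line H v w)"
      using kept[of u v w] kept[of w v u] t triplex_sym[of G u v w] line_sym[of H] by metis
    with t show "triplex H u v w" by (auto simp: triplex_def nonadj E)
  qed
  then have eq: "amp_markov_equivalent G H"
    using adj V by (auto simp: amp_markov_equivalent_iff fun_eq_iff)
  have "{(u, v). arrow H u v} \<subset> {(u, v). arrow G u v}"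
    using ab aA bB by (auto simp: arrowH)
  moreover have "strong_line G u v" if s: "strong_line H u v" for u v
  proof -
    have l: "line H u v" and su: "strong_vertex H u" using s by (auto simp: H.strong_line_iff)
    have clM: "z \<in> M \<longleftrightarrow> y \<in> M" if "line H y z" for y z
      using that clA[of y z] clB[of y z] clA[of z y] clB[of z y] line_sym[of G y z]
      by (auto simp: lineH M_def)
    have pM: "z \<in> M \<longleftrightarrow> y \<in> M" if "(line H)\<^sup>*\<^sup>* y z" for y z
      using that by (induction rule: rtranclp_induct) (auto simp: clM)
    have pG: "(line G)\<^sup>*\<^sup>* y z" if "(line H)\<^sup>*\<^sup>* y z" "y \<notin> M" for y z
      using that
    proof (induction rule: rtranclp_induct)
      case (step z z')
      then have "z \<notin> M" using pM by blast
      then have "line G z z'" using step.hyps by (auto simp: lineH M_def)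
      with step show ?case by (auto intro: rtranclp.rtrancl_into_rtrancl)
    qed simp
    have weakM: "\<not> strong_vertex G y" if "y \<in> M" for y
      using that wa wb strong_vertex_lines[of G y] lines_sym[of G]
      unfolding M_def A_def B_def line_component_def by blast
    \<comment> \<open>Chordless cycles of \<open>H\<close> are present in \<open>G\<close>, where
      \<open>M\<close> is weak, and common parents leave no flag at \<open>M\<close>. So strength in
      \<open>H\<close> originates outside \<open>M\<close>, where the lines of both graphs
      agree.\<close>
    from su have "u \<notin> M \<and> strong_vertex G u"
      unfolding strong_vertex_def[of H]
    proof (elim disjE exE conjE)
      fix vs y assume c: "chordless_undirected_cycle H vs" "y \<in> set vs" "(line H)\<^sup>*\<^sup>* y u"
      have c': "chordless_undirected_cycle G vs"
        by (rule chordless_undirected_cycle_equivalent[OF eq c(1)])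
      with c(2) have "strong_vertex G y" by (auto simp: strong_vertex_def)
      then have y: "y \<notin> M" using weakM by blast
      then have "u \<notin> M" using pM[OF c(3)] by blast
      with pG[OF c(3) y] c' c(2) show ?thesis by (auto simp: strong_vertex_def)
    next
      fix p y z assume c: "flag H p y z" "(line H)\<^sup>*\<^sup>* y u"
      have fl: "nonadjacent G p z" "arrow G p y" "line H y z" "arrow H p y"
        using c(1) by (auto simp: flag_def nonadj arrowH)
      have "y \<notin> M"
      proof
        assume y: "y \<in> M"
        then have z: "z \<in> M" using clM[OF fl(3)] by blast
        have "p \<notin> M"
          using y H.rank_less[OF fl(4)] by (auto simp: g_def)
        then have "arrow G p z" using paM fl(2) y z by blast
        with fl(1) show False by (auto simp: nonadjacent_def adjacent_def arrow_def)
      qed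
      moreover from this have "line G y z" using fl(3) by (auto simp: lineH M_def)
      then have "flag G p y z" using fl by (simp add: flag_def)
      ultimately show ?thesis
        using pM[OF c(2)] pG[OF c(2)] unfolding strong_vertex_def by blast
    qed
    moreover from this have "line G u v" using l by (auto simp: lineH M_def)
    ultimately show ?thesis by (simp add: strong_line_iff)
  qed
  ultimately show ?thesis using cH eq by blast
qed

text \<open>New arrows point into the component that was split, so a flag of \<open>H\<close> either
  occurs in \<open>G\<close> or sits at a vertex that is strong in \<open>G\<close> anyway.
  Strictness comes from a line of the component that was lost.\<close>

lemma (in ranked) split_strong_lines:
  assumes H: "ranked H g" "amp_markov_equivalent G H" and x: "x \<in> verts G" "strong_vertex G x"
    and l: "\<forall>a b. line H a b \<longrightarrow> line G a b"
    and arr: "\<forall>a b. arrow H a b \<longrightarrow> arrow G a b \<or> b \<in> line_component G x"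
    and less: "\<exists>a\<in>line_component G x. \<exists>b. line G a b \<and> \<not> line H a b"
  shows "{(a, b). strong_line H a b} \<subset> {(a, b). strong_line G a b}"
proof -
  interpret H: ranked H g by fact
  have strongX: "strong_vertex G y" if "y \<in> line_component G x" for y
    using that x strong_vertex_lines by (auto simp: line_component_def)
  have lines: "(line G)\<^sup>*\<^sup>* a b" if "(line H)\<^sup>*\<^sup>* a b" for a b
    using that l by (metis mono_rtranclp)
  have nonadj: "nonadjacent H = nonadjacent G"
    using H(2) nonadjacent_cong[of H G] by (auto simp: amp_markov_equivalent_iff)
  have "strong_vertex G a" if "strong_vertex H a" for a
    using that unfolding strong_vertex_def[of H]
  proof (elim disjE exE conjE)
    fix vs v assume c: "chordless_undirected_cycle H vs" "v \<in> set vs" "(line H)\<^sup>*\<^sup>* v a"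
    show ?thesis
      using chordless_undirected_cycle_equivalent[OF H(2) c(1)] c(2) lines[OF c(3)]
      by (auto simp: strong_vertex_def)
  next
    fix p b c assume c: "flag H p b c" "(line H)\<^sup>*\<^sup>* b a"
    show ?thesis
    proof (cases "b \<in> line_component G x")
      case True
      then show ?thesis by (rule strong_vertex_lines[OF strongX lines[OF c(2)]])
    next
      case False
      then have "flag G p b c" using c(1) l arr nonadj by (auto simp: flag_def)
      with lines[OF c(2)] show ?thesis unfolding strong_vertex_def by blast
    qed
  qed
  then have "{(a, b). strong_line H a b} \<subseteq> {(a, b). strong_line G a b}"
    using l by (auto simp: strong_line_iff H.strong_line_iff)
  moreover obtain a b where "a \<in> line_component G x" "line G a b" "\<not> line H a b" using less by blast
  moreover from this have "strong_line G a b" "\<not> strong_line H a b"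
    using strongX by (simp_all add: strong_line_iff H.strong_line_iff)
  ultimately show ?thesis by blast
qed

section \<open>Rigidity under the three conditions\<close>

text \<open>
  If a line of a strong component were an arrow in \<open>H\<close>, a terminal chain component \<open>\<kappa>\<close> of \<open>H\<close>
  restricted to the strong component would contradict property S'.
\<close>

lemma (in ranked) strong_line_rigid:
  assumes S: "property_S' G (line_component G u)"
    and H: "chain_graph H" "amp_markov_equivalent G H"
    and uv: "line G u v"
  shows "line H u v"
proof (rule ccontr)
  assume nl: "\<not> line H u v"
  obtain g where "ranked H g" using chain_graph_ranked[OF H(1)] .
  then interpret H: ranked H g .
  have V: "verts H = verts G" and adj: "adjacent H = adjacent G" and trip: "triplex H = triplex G"
    using H(2) by (simp_all add: amp_markov_equivalent_iff)
  have nonadj: "nonadjacent H = nonadjacent G" using V adj by (rule nonadjacent_cong)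
  define X where "X = line_component G u"
  let ?I = "induced G X" and ?J = "induced G (parent_closure G X)"
  have u: "u \<in> verts G" using uv graph_verts[OF graph] by (auto simp: line_def)
  have XV: "X \<subseteq> verts G" unfolding X_def by (rule line_component_subset[OF u])
  have fin: "finite X" using XV graph finite_subset by (auto simp: graph_def)
  have fX: "f a = f u" if "a \<in> X" for a using that line_component_rank by (simp add: X_def)
  have closed: "b \<in> X" if "a \<in> X" "line G a b" for a b
    using that line_component_line by (simp add: X_def)
  have uX: "u \<in> X" by (simp add: X_def line_component_self)
  have vX: "v \<in> X" using closed uX uv by blast
  have lX: "line G a b" if "a \<in> X" "b \<in> X" "adjacent G a b" for a b
    using adjacent_rank_eq that fX by simp
  \<comment> \<open>\<open>\<kappa>\<close> will be the component of a vertex of maximal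
    \<open>H\<close>-rank in \<open>X\<close>; maximality orients all other edges between
    \<open>\<kappa>\<close> and the rest of \<open>X\<close> into \<open>\<kappa>\<close>.\<close>
  define m where "m = Max (g ` X)"
  have gm: "g a \<le> m" if "a \<in> X" for a using that fin by (simp add: m_def)
  have "m \<in> g ` X" unfolding m_def using fin uX by (intro Max_in) auto
  then obtain z where z: "z \<in> X" "g z = m" by blast
  let ?R = "\<lambda>a b. line H a b \<and> a \<in> X \<and> b \<in> X"
  define \<kappa> where "\<kappa> = {w. ?R\<^sup>*\<^sup>* z w}"
  have kX: "w \<in> X" "g w = m" if "w \<in> \<kappa>" for w
  proof -
    have "?R\<^sup>*\<^sup>* z w" using that by (simp add: \<kappa>_def)
    then have "w \<in> X \<and> g w = m"
      by (induction rule: rtranclp_induct) (use z H.rank_line in auto)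
    then show "w \<in> X" "g w = m" by auto
  qed
  have zk: "z \<in> \<kappa>" by (simp add: \<kappa>_def)
  have kcl: "b \<in> \<kappa>" if "a \<in> \<kappa>" "?R a b" for a b
    using that by (auto simp: \<kappa>_def intro: rtranclp.rtrancl_into_rtrancl)
  have "g u \<noteq> g v"
    using nl H.adjacent_rank_eq[of u v] adj line_imp_adjacent[OF uv] by auto
  then have "\<not> (u \<in> \<kappa> \<and> v \<in> \<kappa>)" using kX(2) by metis
  then have kpsub: "\<kappa> \<subset> X" using kX(1) uX vX by blast
  have into: "arrow H w k" if "w \<in> X - \<kappa>" "k \<in> \<kappa>" "line G w k" for w k
  proof -
    have a: "adjacent H w k" using adj line_imp_adjacent[OF that(3)] by simp
    have "\<not> line H w k" using kcl[of k w] that kX line_sym[of H w k] by blast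
    then have "g w \<noteq> g k" using H.adjacent_rank_eq a by blast
    then have "g w < g k" using gm[of w] kX(2)[of k] that by simp
    with a show ?thesis by (rule H.adjacent_rank_less)
  qed
  have symR: "symp ?R\<^sup>*\<^sup>*" by (intro symp_rtranclp sympI) (auto simp: line_sym)
  \<comment> \<open>If \<open>w\<close> were adjacent to \<open>k1\<close> but not to
    \<open>k2\<close>, the edges \<open>w\<close>, \<open>k1\<close>, \<open>k2\<close> would form a
    flag in \<open>H\<close> but consist of two lines in \<open>G\<close>.\<close>
  have cover: "line G w k'" if w: "w \<in> X - \<kappa>" "k \<in> \<kappa>" "line G w k" and k': "k' \<in> \<kappa>" for w k k'
  proof -
    have "?R\<^sup>*\<^sup>* k z" using w(2) symR by (simp add: \<kappa>_def sympD)
    moreover have "?R\<^sup>*\<^sup>* z k'" using k' by (simp add: \<kappa>_def)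
    ultimately have "?R\<^sup>*\<^sup>* k k'" by (rule rtranclp_trans)
    then have "k' \<in> \<kappa> \<and> line G w k'"
    proof (induction rule: rtranclp_induct)
      case (step k1 k2)
      have k2: "k2 \<in> \<kappa>" using step kcl by blast
      have ar: "arrow H w k1" using into w(1) step.IH by blast
      have "adjacent H k1 k2" using step.hyps(2) by (simp add: line_imp_adjacent)
      then have l12: "line G k1 k2" using adj lX step.hyps(2) by simp
      have "adjacent G w k2"
      proof (rule ccontr)
        assume "\<not> adjacent G w k2"
        then have "nonadjacent G w k2" using w(1) k2 kX(1)[OF k2] XV by (auto simp: nonadjacent_def)
        then have "triplex H w k1 k2"
          using ar step.hyps(2) nonadj by (auto simp: triplex_def arrow_def line_def)
        with trip have "triplex G w k1 k2" by simp
        with l12 step.IH show False by (auto simp: triplex_def)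
      qed
      then show ?case using k2 lX w(1) kX(1)[OF k2] by blast
    qed (use w in auto)
    then show ?thesis by simp
  qed
  define \<alpha> where "\<alpha> = cnb ?I \<kappa>"
  have aX: "\<alpha> \<subseteq> X - \<kappa>" by (auto simp: \<alpha>_def cnb_def verts_induced)
  have ak: "line G a k" if "a \<in> \<alpha>" "k \<in> \<kappa>" for a k
    using that induced_edgesD(1)[of G X a k] by (auto simp: \<alpha>_def cnb_def)
  have nba: "w \<in> \<alpha>" if w: "w \<in> X - \<kappa>" "k \<in> \<kappa>" "line G w k" for w k
  proof -
    have "line ?I w k'" if "k' \<in> \<kappa>" for k'
      using cover[OF w that] w(1) kX(1)[OF that] by (simp add: induced_simps)
    then show ?thesis using w(1) XV by (auto simp: \<alpha>_def cnb_def verts_induced)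
  qed
  have "ncnb ?I \<kappa> = {}"
  proof -
    have "w \<in> cnb ?I \<kappa>" if nb: "w \<in> nb ?I \<kappa>" for w
    proof -
      obtain k where "k \<in> \<kappa>" "line ?I w k" "w \<in> X - \<kappa>"
        using nb by (auto simp: nb_def verts_induced)
      then show ?thesis using nba[of w k] induced_edgesD(1)[of G X w k] by (auto simp: \<alpha>_def)
    qed
    then show ?thesis by (auto simp: ncnb_def)
  qed
  moreover have "\<alpha> \<noteq> {}"
  proof -
    obtain w where w: "w \<in> X" "w \<notin> \<kappa>" using kpsub by blast
    have "(line G)\<^sup>*\<^sup>* z u" "(line G)\<^sup>*\<^sup>* u w"
      using z(1) w(1) lines_sym by (auto simp: X_def line_component_def)
    then have "(line G)\<^sup>*\<^sup>* z w" by (rule rtranclp_trans)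
    then have "w \<notin> \<kappa> \<longrightarrow> (\<exists>a\<in>\<kappa>. \<exists>b. b \<notin> \<kappa> \<and> line G a b)"
      by (induction rule: rtranclp_induct) (use zk in auto)
    then obtain a b where "a \<in> \<kappa>" "b \<notin> \<kappa>" "line G a b" using w by blast
    then have "b \<in> \<alpha>" using nba[of b a] closed[of a b] kX(1) line_sym[of G a b] by auto
    then show ?thesis by blast
  qed
  moreover have "complete_in G \<alpha>"
    unfolding complete_in_def
  proof (intro ballI impI, rule ccontr)
    fix a b assume ab: "a \<in> \<alpha>" "b \<in> \<alpha>" "a \<noteq> b" "\<not> adjacent G a b"
    have "arrow H a z" "arrow H b z" using into[OF _ zk] ab ak[OF _ zk] aX by blast+
    moreover have "nonadjacent H a b" using ab aX XV nonadj by (auto simp: nonadjacent_def)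
    ultimately have "triplex H a z b" by (auto simp: triplex_def arrow_def line_def)
    with trip have "triplex G a z b" by simp
    with ab ak[OF _ zk] line_sym[of G b z] show False by (auto simp: triplex_def)
  qed
  moreover have "connected_in G \<kappa>"
  proof -
    let ?K = "induced G \<kappa>"
    have c: "(adjacent ?K)\<^sup>*\<^sup>* z k" if "k \<in> \<kappa>" for k
    proof -
      have "?R\<^sup>*\<^sup>* z k" using that by (simp add: \<kappa>_def)
      then have "k \<in> \<kappa> \<and> (adjacent ?K)\<^sup>*\<^sup>* z k"
      proof (induction rule: rtranclp_induct)
        case (step a b)
        have b: "b \<in> \<kappa>" using step kcl by blast
        have "adjacent H a b" using step.hyps(2) by (simp add: line_imp_adjacent)
        then have "adjacent G a b" using adj by simp
        then have "adjacent ?K a b" using b step.IH by (simp add: induced_simps)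
        with b step.IH show ?case by (auto intro: rtranclp.rtrancl_into_rtrancl)
      qed (use zk in simp)
      then show ?thesis by simp
    qed
    have "symp (adjacent ?K)\<^sup>*\<^sup>*" by (intro symp_rtranclp sympI) (auto simp: adjacent_sym)
    then have "(adjacent ?K)\<^sup>*\<^sup>* a b" if "a \<in> \<kappa>" "b \<in> \<kappa>" for a b
      using c[OF that(1)] c[OF that(2)] by (meson rtranclp_trans sympD)
    then show ?thesis
      using kX(1) XV by (auto simp: connected_in_def connectivity_def verts_induced)
  qed
  \<comment> \<open>Property S' leaves only a parent \<open>p\<close> of some \<open>a\<close> in
    \<open>\<alpha>\<close> that is not a parent of some \<open>k\<close> in
    \<open>\<kappa>\<close>. This is a flag of \<open>G\<close> with the line \<open>a\<close>,
    \<open>k\<close>, which \<open>H\<close> destroys by its arrow from \<open>a\<close> to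
    \<open>k\<close>.\<close>
  ultimately have "pa ?J \<alpha> - cpa ?J \<kappa> \<noteq> {}"
    using S zk kpsub unfolding property_S'_def X_def[symmetric] \<alpha>_def by blast
  then obtain p a where p: "p \<in> verts ?J" "p \<notin> \<alpha>" "a \<in> \<alpha>" "arrow ?J p a" "p \<notin> cpa ?J \<kappa>"
    by (auto simp: pa_def)
  have pa: "arrow G p a" "p \<in> parent_closure G X" using induced_edgesD(2)[OF p(4)] by auto
  have "f p < f a" by (rule rank_less[OF pa(1)])
  then have fp: "f p < f k" if "k \<in> X" for k using fX[of a] fX[OF that] aX p(3) by auto
  then have "p \<notin> \<kappa>" using kX(1) by blast
  then obtain k where k: "k \<in> \<kappa>" "\<not> arrow ?J p k" using p(1,5) by (auto simp: cpa_def)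
  have kX': "k \<in> X" using kX(1)[OF k(1)] .
  then have "\<not> arrow G p k" using k(2) pa(2) by (simp add: induced_simps parent_closure_def)
  then have "\<not> adjacent G p k" using adjacent_rank_less fp[OF kX'] by blast
  then have "nonadjacent G p k"
    using fp[OF kX'] kX' XV graph_adjacent[OF graph arrow_imp_adjacent[OF pa(1)]]
    by (auto simp: nonadjacent_def)
  then have "triplex G p a k"
    using pa(1) ak[OF p(3) k(1)] by (auto simp: triplex_def arrow_def line_def)
  then have "triplex H p a k" using trip by simp
  moreover have "arrow H a k" using into[OF _ k(1) ak[OF p(3) k(1)]] aX p(3) by blast
  ultimately show False by (auto simp: triplex_def arrow_def)
qed

text \<open>The outer induction on the rank of the head handles arrows below \<open>b\<close>; the
  inner one, for fixed \<open>b\<close>, handles arrows into \<open>b\<close> whose tails have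
  higher rank. The four configurations with strong lines are settled beforehand: since the strong
  lines stay lines in \<open>H\<close>, a reversal at one vertex spreads over its whole
  component.\<close>

lemma (in ranked) arrow_rigid:
  assumes SL: "\<And>u v. line G u v \<Longrightarrow> strong_vertex G u \<Longrightarrow> line H u v"
    and H: "chain_graph H" "amp_markov_equivalent G H"
    and wp: "\<And>a b. arrow G a b \<Longrightarrow> well_protected G a b"
    and ab: "arrow G a b"
  shows "\<not> arrow H b a"
  using ab
proof (induction "f b" arbitrary: a b rule: less_induct)
  case (less b)
  obtain g where "ranked H g" using chain_graph_ranked[OF H(1)] .
  then interpret H: ranked H g .
  have V: "verts H = verts G" and adj: "adjacent H = adjacent G" and trip: "triplex H = triplex G"
    using H(2) by (simp_all add: amp_markov_equivalent_iff)
  have nonadj: "nonadjacent H = nonadjacent G" using V adj by (rule nonadjacent_cong)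
  \<comment> \<open>Not being reversed means that \<open>H\<close> has either the arrow or a line,
    which is all that membership in \<open>edges H\<close> says.\<close>
  have early: "(c, d) \<in> edges H" if "arrow G c d" "f d < f b" for c d
    using less.hyps[OF that(2,1)] arrow_imp_adjacent[OF that(1)] adj
    by (metis adjacent_def arrow_def)
  have inV: "c \<in> verts G \<and> d \<in> verts G" if "adjacent G c d" for c d
    using graph_adjacent[OF graph that] by simp
  have tripI: "triplex G c d e"
    if "nonadjacent G c e" "arrow G c d" "(e, d) \<in> edges G" for c d e
    using that by (auto simp: triplex_def arrow_def line_def)
  have tripHI: "triplex G c d e"
    if "nonadjacent G c e" "arrow H c d" "(e, d) \<in> edges H" for c d e
  proof -
    have "triplex H c d e" using that nonadj by (auto simp: triplex_def arrow_def line_def)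
    then show ?thesis using trip by simp
  qed
  have tripE: "(c, d) \<in> edges H" "(e, d) \<in> edges H" if "triplex G c d e" for c d e
    using that unfolding trip[symmetric] by (simp_all add: triplex_def)
  have tripG: "(c, d) \<in> edges G" "(e, d) \<in> edges G" if "triplex G c d e" for c d e
    using that by (auto simp: triplex_def)
  have no_out: False if s: "strong_vertex G a" and ab: "arrow G a b" and ba: "arrow H b a" for a
  proof -
    have "f a < f b" by (rule rank_less[OF ab])
    have all: "arrow G c b \<and> arrow H b c" if "(line G)\<^sup>*\<^sup>* a c" for c
      using that
    proof (induction rule: rtranclp_induct)
      case (step c d)
      have lH: "line H c d" using SL[OF step.hyps(2) strong_vertex_lines[OF s step.hyps(1)]] .
      have fd: "f d < f b" using rank_less[of c b] step.IH rank_line[OF step.hyps(2)] by simp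
      have "adjacent G d b"
      proof (rule ccontr)
        assume "\<not> adjacent G d b"
        then have "nonadjacent G b d"
          using fd inV[OF line_imp_adjacent[OF step.hyps(2)]] inV[OF arrow_imp_adjacent[OF ab]]
          by (auto simp: nonadjacent_def adjacent_sym)
        then have "triplex G b c d" using tripHI step.IH lH by (auto simp: line_def)
        then show False using tripG(1) step.IH by (auto simp: arrow_def)
      qed
      moreover from this have "arrow H b d"
        using H.adjacent_rank_less[of b d] H.rank_less[of b c] step.IH H.rank_line[OF lH] adj
        by (simp add: adjacent_sym)
      ultimately show ?case using adjacent_rank_less fd by blast
    qed (use ab ba in simp)
    \<comment> \<open>An arrow into \<open>b\<close> from a vertex not adjacent to \<open>d\<close>
      forms an immorality with the arrow from \<open>d\<close>, yet \<open>H\<close> points from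
      \<open>b\<close> to \<open>d\<close>.\<close>
    have im: False if "arrow G c b" "nonadjacent G c d" "(line G)\<^sup>*\<^sup>* a d" for c d
      using tripE(2)[OF tripI[OF that(2,1)]] all[OF that(3)] by (auto simp: arrow_def)
    show False
      using s unfolding strong_vertex_def
    proof (elim disjE exE conjE)
      fix vs v assume c: "chordless_undirected_cycle G vs" "v \<in> set vs" "(line G)\<^sup>*\<^sup>* v a"
      have "(line G)\<^sup>*\<^sup>* a w" if "w \<in> set vs" for w
        using chordless_undirected_cycle_lines[OF c(1,2) that] lines_sym[OF c(3)] by simp
      then show False using im[of "vs ! 0" "vs ! 2"] all chordless_not_adjacent[OF c(1)] by blast
    next
      fix p x y assume c: "flag G p x y" "(line G)\<^sup>*\<^sup>* x a"
      have fl: "nonadjacent G p y" "arrow G p x" "line G x y" using c by (auto simp: flag_def)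
      have ax: "(line G)\<^sup>*\<^sup>* a x" by (rule lines_sym[OF c(2)])
      then have ay: "(line G)\<^sup>*\<^sup>* a y" using fl(3) by (rule rtranclp.rtrancl_into_rtrancl)
      have x: "arrow G x b" "arrow H b x" using all[OF ax] by auto
      have fx: "f p < f x" "f x < f b" using rank_less fl(2) x(1) by auto
      \<comment> \<open>If \<open>p\<close> is adjacent to \<open>b\<close>, then \<open>p\<close>
        and \<open>y\<close> are nonadjacent parents of \<open>b\<close>. Otherwise \<open>H\<close>
        has a triplex at \<open>x\<close> with ends \<open>b\<close> and \<open>p\<close>, whereas
        \<open>G\<close> has an arrow from \<open>x\<close> to \<open>b\<close>.\<close>
      show False
      proof (cases "adjacent G p b")
        case True
        then have "arrow G p b" using adjacent_rank_less fx by simp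
        from im[OF this fl(1) ay] show False .
      next
        case False
        then have "nonadjacent G b p"
          using fx inV[OF arrow_imp_adjacent[OF fl(2)]] inV[OF arrow_imp_adjacent[OF x(1)]]
          by (auto simp: nonadjacent_def adjacent_sym)
        then have "triplex G b x p" using tripHI x(2) early[OF fl(2) fx(2)] by blast
        from tripG(1)[OF this] x(1) show False by (simp add: arrow_def)
      qed
    qed
  qed
  \<comment> \<open>Counterpart of \<open>no_out\<close> for a strong head: all arrows from
    \<open>a\<close> into the component of \<open>b\<close> are reversed, so nonadjacent vertices of
    a chordless cycle there become an immorality at \<open>a\<close>.\<close>
  have no_in: False if s: "strong_vertex G b" and ab: "arrow G a b" and ba: "arrow H b a" for a
  proof -
    have fab: "f a < f b" by (rule rank_less[OF ab])
    have all: "arrow G a c \<and> arrow H c a" if "(line G)\<^sup>*\<^sup>* b c" for c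
      using that
    proof (induction rule: rtranclp_induct)
      case (step c d)
      have lH: "line H c d" using SL[OF step.hyps(2) strong_vertex_lines[OF s step.hyps(1)]] .
      have fd: "f a < f d" using rank_less[of a c] step.IH rank_line[OF step.hyps(2)] by simp
      have "adjacent G a d"
      proof (rule ccontr)
        assume "\<not> adjacent G a d"
        then have "nonadjacent G a d"
          using fd inV[OF line_imp_adjacent[OF step.hyps(2)]] inV[OF arrow_imp_adjacent[OF ab]]
          by (auto simp: nonadjacent_def)
        then have "triplex G a c d" using tripI step.IH step.hyps(2) by (auto simp: line_def)
        then show False using tripE(1) step.IH by (auto simp: arrow_def)
      qed
      moreover from this have "arrow H d a"
        using H.adjacent_rank_less[of d a] H.rank_less[of c a] step.IH H.rank_line[OF lH] adj
        by (simp add: adjacent_sym)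
      ultimately show ?case using adjacent_rank_less fd by blast
    qed (use ab ba in simp)
    show False
      using s unfolding strong_vertex_def
    proof (elim disjE exE conjE)
      fix vs v assume c: "chordless_undirected_cycle G vs" "v \<in> set vs" "(line G)\<^sup>*\<^sup>* v b"
      have w: "arrow G a w \<and> arrow H w a" if "w \<in> set vs" for w
        using chordless_undirected_cycle_lines[OF c(1,2) that] lines_sym[OF c(3)] by (intro all) simp
      have "triplex G (vs ! 0) a (vs ! 2)"
        using w chordless_not_adjacent[OF c(1)] by (intro tripHI) (auto simp: arrow_def)
      from tripG(1)[OF this] w chordless_not_adjacent(1)[OF c(1)] show False by (auto simp: arrow_def)
    next
      fix p x y assume c: "flag G p x y" "(line G)\<^sup>*\<^sup>* x b"
      have fl: "nonadjacent G p y" "arrow G p x" "line G x y" using c by (auto simp: flag_def)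
      have bx: "(line G)\<^sup>*\<^sup>* b x" by (rule lines_sym[OF c(2)])
      then have "(line G)\<^sup>*\<^sup>* b y" using fl(3) by (rule rtranclp.rtrancl_into_rtrancl)
      then have x: "arrow G a x" "arrow H x a" and y: "arrow G a y" "arrow H y a"
        using all bx by auto
      have gxa: "g x < g a" by (rule H.rank_less[OF x(2)])
      have fp: "f p < f b" using rank_less[OF fl(2)] rank_lines[OF bx] by simp
      have "triplex G p x y" using tripI fl by (simp add: line_def)
      then have px: "g p \<le> g x" using tripE(1) H.rank_le by blast
      have pa: "p \<noteq> a" using fl(1) arrow_imp_adjacent[OF y(1)] by (auto simp: nonadjacent_def)
      have na: "\<not> triplex G y a p" using tripG(1)[of y a p] y(1) by (auto simp: arrow_def)
      have yp: "nonadjacent G y p" using fl(1) by (simp add: nonadjacent_sym)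
      \<comment> \<open>Nonadjacency gives an immorality at \<open>x\<close> that \<open>H\<close>
        lacks. If \<open>H\<close> had the pair from \<open>p\<close> to \<open>a\<close>, there
        would be a triplex at \<open>a\<close> with ends \<open>y\<close> and \<open>p\<close>. In
        the remaining cases \<open>a\<close> is at most as high as \<open>p\<close> in
        \<open>H\<close>, and \<open>p\<close> at most as high as \<open>x\<close>, contrary to
        \<open>gxa\<close>.\<close>
      consider "\<not> adjacent G p a" | "arrow G p a" | "arrow G a p" | "line G p a"
        by (auto simp: adjacent_def arrow_def line_def)
      then show False
      proof cases
        case 1
        then have "nonadjacent G a p"
          using pa inV[OF arrow_imp_adjacent[OF x(1)]] inV[OF arrow_imp_adjacent[OF fl(2)]]
          by (auto simp: nonadjacent_def adjacent_sym)
        then have "triplex G a x p" using tripI x(1) fl(2) by (simp add: arrow_def)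
        from tripE(1)[OF this] x(2) show False by (simp add: arrow_def)
      next
        case 2
        then show False using tripHI[OF yp y(2) early[OF _ fab]] na by blast
      next
        case 3
        from H.rank_le[OF early[OF this fp]] px gxa show False by simp
      next
        case 4
        have "(p, a) \<notin> edges H" using tripHI[OF yp y(2)] na by blast
        then have "arrow H a p"
          using adj line_imp_adjacent[OF 4] by (metis adjacent_def arrow_def)
        from H.rank_less[OF this] px gxa show False by simp
      qed
    qed
  qed
  from less.prems show ?case
  \<comment> \<open>This measure drops in configuration (iii) on passing to the arrow from
    \<open>c\<close> to \<open>b\<close>, as \<open>c\<close> ranks strictly between
    \<open>a\<close> and \<open>b\<close>.\<close>
  proof (induction "f b - f a" arbitrary: a rule: less_induct)
    case (less a)
    note ab = less.prems
    have fab: "f a < f b" by (rule rank_less[OF ab])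
    show ?case
    proof
      assume ba: "arrow H b a"
      then have gba: "g b < g a" by (rule H.rank_less)
      from wp[OF ab] show False
        unfolding well_protected_def
      proof (elim conjE disjE exE)
        fix c assume c: "arrow G c a" "nonadjacent G c b"
        have "(c, a) \<in> edges H" by (rule early[OF c(1) fab])
        then have "triplex G b a c" using c(2) ba by (intro tripHI) (simp_all add: nonadjacent_sym)
        from tripG(1)[OF this] ab show False by (simp add: arrow_def)
      next
        fix c assume c: "arrow G c b" "nonadjacent G a c"
        then have "triplex G a b c" using ab by (intro tripI) (simp_all add: arrow_def)
        from tripE(1)[OF this] ba show False by (simp add: arrow_def)
      next
        fix c assume c: "arrow G a c" "arrow G c b"
        have fc: "f a < f c" "f c < f b" using c rank_less by auto
        have "g a \<le> g c" by (rule H.rank_le[OF early[OF c(1) fc(2)]])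
        moreover have "\<not> arrow H b c" using less.hyps[of c] c(2) fc by simp
        then have "(c, b) \<in> edges H"
          using arrow_imp_adjacent[OF c(2)] adj by (metis adjacent_def arrow_def)
        then have "g c \<le> g b" by (rule H.rank_le)
        ultimately show False using gba by simp
      next
        \<comment> \<open>The immorality at \<open>b\<close> keeps \<open>c\<close> and
          \<open>d\<close> no higher than \<open>b\<close> in \<open>H\<close>, hence strictly below
          \<open>a\<close>. Their lines to \<open>a\<close> then become an immorality at
          \<open>a\<close>.\<close>
        fix c d assume c: "arrow G c b" "arrow G d b" "line G a c" "line G a d" "nonadjacent G c d"
        have t: "triplex G c b d" using c by (intro tripI) (simp_all add: arrow_def)
        have "g c < g a" "g d < g a" using H.rank_le[OF tripE(1)[OF t]] H.rank_le[OF tripE(2)[OF t]] gba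
          by simp_all
        then have "arrow H c a" "arrow H d a"
          using H.adjacent_rank_less adj c(3,4) line_imp_adjacent adjacent_sym by metis+
        then have "triplex G c a d" using c(5) by (intro tripHI) (simp_all add: arrow_def)
        with c(3,4) show False by (simp add: triplex_def line_sym)
      next
        fix c assume "arrow G c b" "strong_line G a c"
        then show False using no_out[OF _ ab ba] by (simp add: strong_line_iff)
      next
        fix c assume "strong_line G c a" "nonadjacent G c b"
        then have "strong_vertex G a" using strong_vertex_lines[of G c a] by (auto simp: strong_line_iff)
        then show False using no_out ab ba by blast
      next
        fix c assume "strong_line G b c" "nonadjacent G a c"
        then show False using no_in[OF _ ab ba] by (simp add: strong_line_iff)
      next
        fix c assume "arrow G a c" "strong_line G b c"
        then show False using no_in[OF _ ab ba] by (simp add: strong_line_iff)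
      qed
    qed
  qed
qed

lemma (in ranked) essential_graph_eq:
  assumes S: "\<And>\<xi>. \<xi> \<in> strong_chain_components G \<Longrightarrow> property_S' G \<xi>"
    and wp: "\<And>a b. arrow G a b \<Longrightarrow> well_protected G a b"
  shows "essential_graph {H. chain_graph H \<and> amp_markov_equivalent G H} = G"
proof -
  let ?C = "{H. chain_graph H \<and> amp_markov_equivalent G H}"
  have GC: "G \<in> ?C"
    using ranked_imp_chain_graph[OF ranked_axioms] by (simp add: amp_markov_equivalent_def)
  have SL: "line H u v" if "H \<in> ?C" "line G u v" "strong_vertex G u" for H u v
  proof (rule strong_line_rigid)
    have "u \<in> verts G" using that(2) graph_verts[OF graph] by (auto simp: line_def)
    then show "property_S' G (line_component G u)"
      using that(3) by (intro S) (auto simp: strong_chain_components_iff)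
  qed (use that in simp_all)
  have arr: "\<not> arrow H b a" if "H \<in> ?C" "arrow G a b" for H a b
    using that SL[OF that(1)] wp by (intro arrow_rigid[of H a b]) auto
  have weak: "\<exists>H\<in>?C. arrow H a b" if "line G a b" "\<not> strong_vertex G a" for a b
    using orient_weak_line[OF that] by blast
  have same: "verts H = verts G" "adjacent H = adjacent G" if "H \<in> ?C" for H
    using that by (simp_all add: amp_markov_equivalent_iff)
  have ess: "essential_arrow ?C a b \<longleftrightarrow> arrow G a b" for a b
  proof
    show "essential_arrow ?C a b" if "arrow G a b"
      unfolding essential_arrow_def using that GC arr by blast
    show "arrow G a b" if e: "essential_arrow ?C a b"
    proof -
      obtain H where H: "H \<in> ?C" "arrow H a b" using e by (auto simp: essential_arrow_def)
      have "adjacent G a b" using arrow_imp_adjacent[OF H(2)] same(2)[OF H(1)] by simp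
      moreover have "\<not> arrow G b a" using e GC by (auto simp: essential_arrow_def)
      moreover have "\<not> line G a b"
      proof
        assume l: "line G a b"
        show False
        proof (cases "strong_vertex G a")
          case True
          from SL[OF H(1) l True] H(2) show False by (simp add: line_def arrow_def)
        next
          case False
          then have "\<not> strong_vertex G b"
            using strong_vertex_lines[of G b a] l line_sym[of G a b] by blast
          then have "\<exists>H\<in>?C. arrow H b a" using weak l line_sym[of G a b] by blast
          with e show False by (simp add: essential_arrow_def)
        qed
      qed
      ultimately show ?thesis by (auto simp: adjacent_def arrow_def line_def)
    qed
  qed
  have "(\<Union>H\<in>?C. verts H) = verts G" using GC same(1) by blast
  moreover have "(\<exists>H\<in>?C. adjacent H a b) \<longleftrightarrow> adjacent G a b" for a b using GC same(2) by metis
  then have "{(a, b). essential_arrow ?C a b} \<union> {(a, b). (\<exists>H\<in>?C. adjacent H a b) \<and>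
      \<not> essential_arrow ?C a b \<and> \<not> essential_arrow ?C b a} = edges G"
    unfolding ess by (auto simp: adjacent_def arrow_def)
  ultimately show ?thesis unfolding essential_graph_def by simp
qed

section \<open>Properties S and S'\<close>

text \<open>Once the first alternative fails, both properties speak of the same pairs. If all
  neighbours of a connected \<open>\<kappa>\<close> are covering, then \<open>\<kappa>\<close> is a
  whole component of the covering neighbours of \<open>\<alpha>\<close>; if such a component has no
  neighbours outside \<open>\<alpha>\<close>, its covering neighbours are exactly
  \<open>\<alpha>\<close>.\<close>

lemma (in ranked) property_S_iff_S':
  assumes "\<xi> \<in> chain_components G"
  shows "property_S G \<xi> \<longleftrightarrow> property_S' G \<xi>"
proof -
  obtain x where x: "x \<in> verts G" "\<xi> = line_component G x" using assms chain_components_iff by blast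
  let ?I = "induced G \<xi>" and ?J = "induced G (parent_closure G \<xi>)"
  have XV: "\<xi> \<subseteq> verts G" using x line_component_subset by simp
  have lX: "line G a b" if "a \<in> \<xi>" "b \<in> \<xi>" "adjacent G a b" for a b
    using adjacent_rank_eq that line_component_rank x by metis
  have cnbI: "v \<in> cnb ?I A \<longleftrightarrow> v \<in> \<xi> - A \<and> (\<forall>a\<in>A. line G v a)" if "A \<subseteq> \<xi>" for v A
  proof -
    have "line ?I v a \<longleftrightarrow> line G v a" if "a \<in> A" "v \<in> \<xi>" for a
      using that \<open>A \<subseteq> \<xi>\<close> by (intro induced_simps) auto
    then show ?thesis using XV by (auto simp: cnb_def verts_induced)
  qed
  have nbI: "v \<in> nb ?I A \<longleftrightarrow> v \<in> \<xi> - A \<and> (\<exists>a\<in>A. line G v a)" if "A \<subseteq> \<xi>" for v A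
  proof -
    have "line ?I v a \<longleftrightarrow> line G v a" if "a \<in> A" "v \<in> \<xi>" for a
      using that \<open>A \<subseteq> \<xi>\<close> by (intro induced_simps) auto
    then show ?thesis using XV by (auto simp: nb_def verts_induced)
  qed
  show ?thesis
  proof
    assume S: "property_S G \<xi>"
    show "property_S' G \<xi>"
      unfolding property_S'_def
    proof (intro allI impI, elim conjE)
      fix \<kappa> \<alpha> assume k: "\<kappa> \<noteq> {}" "\<kappa> \<subset> \<xi>" "connected_in G \<kappa>"
        and a: "\<alpha> = cnb ?I \<kappa>" "\<alpha> \<noteq> {}" "complete_in G \<alpha>"
      show "ncnb ?I \<kappa> \<noteq> {} \<or> pa ?J \<alpha> - cpa ?J \<kappa> \<noteq> {}"
      proof (cases "ncnb ?I \<kappa> = {}")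
        case True
        have kX: "\<kappa> \<subseteq> \<xi>" using k(2) by blast
        have aX: "\<alpha> \<subseteq> \<xi> - \<kappa>" "\<alpha> \<subseteq> \<xi>" using a(1) cnbI[OF kX] by auto
        have ak: "line G v w" if "v \<in> \<alpha>" "w \<in> \<kappa>" for v w using that a(1) cnbI[OF kX] by auto
        define K where "K = cnb ?I \<alpha>"
        have kK: "\<kappa> \<subseteq> K"
        proof
          fix w assume w: "w \<in> \<kappa>"
          then have "line G w v" if "v \<in> \<alpha>" for v using ak[OF that w] by (simp add: line_sym)
          then show "w \<in> K" using w kX aX(1) unfolding K_def cnbI[OF aX(2)] by blast
        qed
        have nbsub: "v \<in> \<alpha>" if "v \<in> nb ?I \<kappa>" for v using True a(1) that by (auto simp: ncnb_def)
        have KX: "K \<subseteq> \<xi> - \<alpha>" unfolding K_def using cnbI[OF aX(2)] by auto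
        have cl: "w \<in> \<kappa>" if "v \<in> \<kappa>" "adjacent (induced G K) v w" for v w
        proof (rule ccontr)
          assume w: "w \<notin> \<kappa>"
          have "adjacent G v w" "w \<in> K" using that(2) induced_edgesD(3) by metis+
          then have "line G w v" using lX[of w v] that(1) kX KX adjacent_sym[of G v w] by blast
          then have "w \<in> nb ?I \<kappa>" using nbI[OF kX] w that(1) \<open>w \<in> K\<close> KX by blast
          then show False using nbsub \<open>w \<in> K\<close> KX by blast
        qed
        obtain k0 where k0: "k0 \<in> \<kappa>" using k(1) by blast
        have "connectivity (induced G K) `` {k0} = \<kappa>"
        proof
          have "v \<in> \<kappa>" if "(adjacent (induced G K))\<^sup>*\<^sup>* k0 v" for v
            using that by (induction rule: rtranclp_induct) (use k0 cl in auto)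
          then show "connectivity (induced G K) `` {k0} \<subseteq> \<kappa>" by (auto simp: connectivity_def)
          show "\<kappa> \<subseteq> connectivity (induced G K) `` {k0}"
          proof
            fix v assume v: "v \<in> \<kappa>"
            have "(adjacent (induced G \<kappa>))\<^sup>*\<^sup>* k0 v"
              using k(3) k0 v by (auto simp: connected_in_def connectivity_def)
            moreover have "adjacent (induced G \<kappa>) s t \<longrightarrow> adjacent (induced G K) s t" for s t
              using kK by (auto simp: adjacent_def induced_def)
            ultimately have "(adjacent (induced G K))\<^sup>*\<^sup>* k0 v" by (metis mono_rtranclp)
            then show "v \<in> connectivity (induced G K) `` {k0}"
              using k0 v kK kX XV by (auto simp: connectivity_def verts_induced)
          qed
        qed
        then have "\<kappa> \<in> connected_components (induced G K)"
          using k0 kK kX XV by (auto simp: connected_components_def quotient_def verts_induced)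
        moreover have "\<alpha> \<subset> \<xi>" "K \<noteq> {}" using aX k0 kX kK by blast+
        ultimately have "nb ?I \<kappa> - \<alpha> \<noteq> {} \<or> pa ?J \<alpha> - cpa ?J \<kappa> \<noteq> {}"
          using S a(2,3) unfolding property_S_def K_def by blast
        then show ?thesis using nbsub by blast
      qed blast
    qed
  next
    assume S': "property_S' G \<xi>"
    show "property_S G \<xi>"
      unfolding property_S_def
    proof (intro allI impI ballI, elim conjE)
      fix \<alpha> K \<kappa> assume a: "\<alpha> \<noteq> {}" "\<alpha> \<subset> \<xi>" "complete_in G \<alpha>" and K: "K = cnb ?I \<alpha>" "K \<noteq> {}"
        and k: "\<kappa> \<in> connected_components (induced G K)"
      show "nb ?I \<kappa> - \<alpha> \<noteq> {} \<or> pa ?J \<alpha> - cpa ?J \<kappa> \<noteq> {}"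
      proof (cases "nb ?I \<kappa> - \<alpha> = {}")
        case True
        have aX: "\<alpha> \<subseteq> \<xi>" using a(2) by blast
        have KX: "K \<subseteq> \<xi> - \<alpha>" using K(1) cnbI[OF aX] by auto
        obtain k0 where k0: "k0 \<in> K" "\<kappa> = connectivity (induced G K) `` {k0}"
          using k by (auto simp: connected_components_def quotient_def verts_induced)
        have kk: "k0 \<in> \<kappa>" using k0 KX XV by (auto simp: connectivity_def verts_induced)
        have kK: "\<kappa> \<subseteq> K" using k0(2) by (auto simp: connectivity_def verts_induced)
        have kX: "\<kappa> \<subseteq> \<xi>" using kK KX by blast
        have cnb: "cnb ?I \<kappa> = \<alpha>"
        proof
          have "v \<in> nb ?I \<kappa>" if "v \<in> cnb ?I \<kappa>" for v
            using that kk unfolding cnbI[OF kX] nbI[OF kX] by blast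
          then show "cnb ?I \<kappa> \<subseteq> \<alpha>" using True by blast
          show "\<alpha> \<subseteq> cnb ?I \<kappa>"
          proof
            fix v assume v: "v \<in> \<alpha>"
            have "line G v w" if "w \<in> \<kappa>" for w
              using that v kK K(1) cnbI[OF aX, of w] line_sym[of G w v] by blast
            then show "v \<in> cnb ?I \<kappa>" using v aX kK KX by (auto simp: cnbI[OF kX])
          qed
        qed
        have c: "v \<in> \<kappa> \<and> (adjacent (induced G \<kappa>))\<^sup>*\<^sup>* k0 v" if "(adjacent (induced G K))\<^sup>*\<^sup>* k0 v" for v
          using that
        proof (induction rule: rtranclp_induct)
          case (step s t)
          have st: "adjacent G s t" "t \<in> K" using step.hyps(2) induced_edgesD(3) by metis+
          have "(adjacent (induced G K))\<^sup>*\<^sup>* k0 t" using step.hyps by (rule rtranclp.rtrancl_into_rtrancl)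
          then have "t \<in> \<kappa>" using st k0 KX XV by (auto simp: connectivity_def verts_induced)
          moreover from this have "adjacent (induced G \<kappa>) s t" using st step.IH by (simp add: induced_simps)
          ultimately show ?case using step.IH by (auto intro: rtranclp.rtrancl_into_rtrancl)
        qed (use kk in simp)
        have "symp (adjacent (induced G \<kappa>))\<^sup>*\<^sup>*"
          by (intro symp_rtranclp sympI) (auto simp: adjacent_sym)
        moreover have "(adjacent (induced G \<kappa>))\<^sup>*\<^sup>* k0 v" if "v \<in> \<kappa>" for v
          using that c k0(2) by (auto simp: connectivity_def)
        ultimately have "(adjacent (induced G \<kappa>))\<^sup>*\<^sup>* v w" if "v \<in> \<kappa>" "w \<in> \<kappa>" for v w
          using that by (meson rtranclp_trans sympD)
        then have "connected_in G \<kappa>"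
          using kX XV by (auto simp: connected_in_def connectivity_def verts_induced)
        moreover have "ncnb ?I \<kappa> = {}" unfolding ncnb_def cnb using True .
        moreover have "\<kappa> \<subset> \<xi>" using kK KX a by blast
        ultimately show ?thesis using S' a cnb kk unfolding property_S'_def by blast
      qed blast
    qed
  qed
qed

section \<open>The characterization\<close>

text \<open>
  A member of the class that minimizes lexicographically the number of strong lines and then the
  number of arrows admits neither \<open>split_component\<close> nor \<open>merge_components\<close>.
\<close>

lemma minimal_member:
  assumes G: "chain_graph G"
  obtains M where "chain_graph M" "amp_markov_equivalent G M"
    "\<And>\<xi>. \<xi> \<in> strong_chain_components M \<Longrightarrow> property_S' M \<xi>"
    "\<And>a b. arrow M a b \<Longrightarrow> well_protected M a b"
proof -
  let ?C = "{H. chain_graph H \<and> amp_markov_equivalent G H}"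
  let ?s = "\<lambda>H :: 'a mixed_graph. card {(a, b). strong_line H a b}"
  let ?a = "\<lambda>H :: 'a mixed_graph. card {(a, b). arrow H a b}"
  \<comment> \<open>The order of the two counts matters: a split turns lines into arrows, so it may
    increase the second count, whereas a merge decreases the second without increasing the
    first.\<close>
  let ?r = "inv_image (less_than <*lex*> less_than) (\<lambda>H. (?s H, ?a H))"
  have "wf ?r" by (intro wf_inv_image wf_lex_prod wf_less_than)
  moreover have "G \<in> ?C" using G by (simp add: amp_markov_equivalent_def)
  ultimately obtain M where M: "M \<in> ?C" and min: "\<And>H. (H, M) \<in> ?r \<Longrightarrow> H \<notin> ?C"
    by (rule wfE_min) blast
  obtain f where "ranked M f" using chain_graph_ranked M by blast
  then interpret ranked M f .
  have trans: "H \<in> ?C" if "chain_graph H" "amp_markov_equivalent M H" for H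
    using that M by (auto simp: amp_markov_equivalent_def)
  have fin: "finite (edges M)" using graph finite_subset by (auto simp: graph_def)
  have fs: "finite {(a, b). strong_line M a b}"
    by (rule finite_subset[OF _ fin]) (auto simp: strong_line_def line_def)
  have fa: "finite {(a, b). arrow M a b}"
    by (rule finite_subset[OF _ fin]) (auto simp: arrow_def)
  have "property_S' M \<xi>" if xi: "\<xi> \<in> strong_chain_components M" for \<xi>
  proof (rule ccontr)
    assume n: "\<not> property_S' M \<xi>"
    obtain x where x: "x \<in> verts M" "\<xi> = line_component M x" "strong_vertex M x"
      using xi strong_chain_components_iff by blast
    obtain H where H: "chain_graph H" "amp_markov_equivalent M H"
      and l: "\<forall>a b. line H a b \<longrightarrow> line M a b"
        "\<forall>a b. arrow H a b \<longrightarrow> arrow M a b \<or> b \<in> line_component M x"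
        "\<exists>a\<in>line_component M x. \<exists>b. line M a b \<and> \<not> line H a b"
      using split_component[OF x(1)] n x(2) by blast
    obtain g where "ranked H g" using chain_graph_ranked H(1) by blast
    from psubset_card_mono[OF fs split_strong_lines[OF this H(2) x(1,3) l]]
    have "(H, M) \<in> ?r" by simp
    with min trans H show False by blast
  qed
  moreover have "well_protected M a b" if ab: "arrow M a b" for a b
  proof (rule ccontr)
    assume n: "\<not> well_protected M a b"
    obtain H where H: "chain_graph H" "amp_markov_equivalent M H"
      and l: "{(u, v). arrow H u v} \<subset> {(u, v). arrow M u v}"
        "{(u, v). strong_line H u v} \<subseteq> {(u, v). strong_line M u v}"
      using merge_components[OF ab n] by blast
    from psubset_card_mono[OF fa l(1)] card_mono[OF fs l(2)]
    have "(H, M) \<in> ?r" by auto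
    with min trans H show False by blast
  qed
  ultimately show thesis using M that by blast
qed

theorem theorem5p1:
  fixes G :: "'a mixed_graph"
  assumes "graph G"
  shows "(is_amp_essential_graph G \<longleftrightarrow>
            adicyclic G \<and>
            (\<forall>\<xi>\<in>strong_chain_components G. property_S G \<xi>) \<and>
            (\<forall>a b. arrow G a b \<longrightarrow> well_protected G a b)) \<and>
         (is_amp_essential_graph G \<longleftrightarrow>
            adicyclic G \<and>
            (\<forall>\<xi>\<in>strong_chain_components G. property_S' G \<xi>) \<and>
            (\<forall>a b. arrow G a b \<longrightarrow> well_protected G a b))"
proof -
  let ?P = "adicyclic G \<and> (\<forall>\<xi>\<in>strong_chain_components G. property_S' G \<xi>) \<and>
    (\<forall>a b. arrow G a b \<longrightarrow> well_protected G a b)"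
  have "property_S G \<xi> \<longleftrightarrow> property_S' G \<xi>" if "adicyclic G" "\<xi> \<in> strong_chain_components G" for \<xi>
  proof -
    have "chain_graph G" using that(1) assms by (simp add: chain_graph_def)
    then obtain f where "ranked G f" by (rule chain_graph_ranked)
    then show ?thesis
      using that(2) by (intro ranked.property_S_iff_S') (auto simp: strong_chain_components_def)
  qed
  moreover have "is_amp_essential_graph G \<longleftrightarrow> ?P"
  proof
    assume "is_amp_essential_graph G"
    then obtain G0 where G0: "chain_graph G0"
      and G: "G = essential_graph {H. chain_graph H \<and> amp_markov_equivalent G0 H}"
      by (auto simp: is_amp_essential_graph_def amp_equivalence_class_def)
    obtain M where M: "chain_graph M" "amp_markov_equivalent G0 M"
      and S: "\<And>\<xi>. \<xi> \<in> strong_chain_components M \<Longrightarrow> property_S' M \<xi>"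
      and wp: "\<And>a b. arrow M a b \<Longrightarrow> well_protected M a b"
      using minimal_member[OF G0] by blast
    obtain f where "ranked M f" using chain_graph_ranked M(1) .
    then interpret ranked M f .
    \<comment> \<open>Equivalence is equality of skeletons and triplexes, so the class of
      \<open>G0\<close> is also the class of \<open>M\<close>.\<close>
    have "G = essential_graph {H. chain_graph H \<and> amp_markov_equivalent M H}"
      using G M(2) by (simp add: amp_markov_equivalent_def)
    also have "\<dots> = M" by (rule essential_graph_eq[OF S wp])
    finally show ?P using M(1) S wp by (simp add: chain_graph_def)
  next
    assume P: ?P
    with assms have G: "chain_graph G" by (simp add: chain_graph_def)
    then obtain f where "ranked G f" by (rule chain_graph_ranked)
    then interpret ranked G f .
    have "essential_graph {H. chain_graph H \<and> amp_markov_equivalent G H} = G"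
      using P by (intro essential_graph_eq) auto
    with G show "is_amp_essential_graph G"
      unfolding is_amp_essential_graph_def amp_equivalence_class_def by metis
  qed
  ultimately show ?thesis by blast
qed

end
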